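(* Let $n\ge 2$, $s\in(0,1)$, and let $\omega\subseteq\mathbb{R}^n$ be a bounded open set such that $\Omega:=\omega\times\mathbb{R}\subseteq\mathbb{R}^{n+1}$ has Lipschitz boundary. Write points of $\mathbb{R}^{n+1}$ as $X=(x',x_n,x_{n+1})\in\mathbb{R}^{n-1}\times\mathbb{R}\times\mathbb{R}$. Suppose that there exist $\rho>0$ and $\varphi:\mathbb{R}^{n-1}\to[0,+\infty)$ with $\varphi(0)=0$ and $$\varphi(x')\ge c|x'|^\beta\quad\text{for all }x'\in\mathbb{R}^{n-1}\text{ with }|x'|<\rho,$$ for some $c>0$ and $\beta\in(0,s+1]$, and such that $$\omega\cap B_\rho=\{x_n>\varphi(x')\}\cap B_\rho .$$ Assume that $E_0=\{x_{n+1}<\psi(x',x_n)\}$ for some $\psi\in L^\infty_{\rm loc}(\mathbb{R}^n)$ such that $\psi(x',x_n)\le 0$ for all $(x',x_n)\in B_\rho$. Let $E$ be an $s$-minimal set in $\Omega$ with $E\setminus\Omega=E_0\setminus\Omega$. Then for every $\varepsilon>0$ there exists $\delta>0$ such that $$E\cap C_\delta\subseteq\{x_{n+1}\le\varepsilon\}.$$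
   Context: For $s\in(0,1)$ and measurable $A,B\subseteq\mathbb{R}^{n+1}$, $L_s(A,B):=\iint_{A\times B}|x-y|^{-(n+1+s)}\,dx\,dy$. For an open set $U\subseteq\mathbb{R}^{n+1}$ and $E\subseteq\mathbb{R}^{n+1}$, the $s$-perimeter is $\operatorname{Per}_s(E,U):=L_s(E\cap U,E^c\cap U)+L_s(E\cap U,E^c\cap U^c)+L_s(E\cap U^c,E^c\cap U)$, where superscript $c$ denotes complement in $\mathbb{R}^{n+1}$. If $U$ is bounded, $E$ is $s$-minimal in $U$ if $\operatorname{Per}_s(E,U)<+\infty$ and $\operatorname{Per}_s(E,U)\le\operatorname{Per}_s(F,U)$ for all $F$ with $E\setminus U=F\setminus U$. For the unbounded cylinder $\Omega=\omega\times\mathbb{R}$, $E$ is $s$-minimal in $\Omega$ if it is $s$-minimal in every bounded open set $\Omega'\subseteq\Omega$. $B_\rho$ denotes the ball $\{x\in\mathbb{R}^n:|x|<\rho\}$ (identified with $B_\rho\times\{0\}$), and $C_\delta:=B_\delta\times\mathbb{R}\subseteq\mathbb{R}^{n+1}$.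
   Formalization: E is taken normalized in Ω: a point of Ω with a neighbourhood in which E has full measure lies in E, one with a neighbourhood in which E is null does not; otherwise adding to E the null set of points (0,1/k,10) refutes the pointwise inclusion. *)

theory Defs
  imports "HOL-Analysis.Analysis"
begin

definition Ls :: "real \<Rightarrow> 'b::euclidean_space set \<Rightarrow> 'b set \<Rightarrow> ennreal" where
  "Ls s A B = (\<integral>\<^sup>+ p. indicator (A \<times> B) p *
      ennreal (norm (fst p - snd p) powr (- (real DIM('b) + s))) \<partial>(lebesgue \<Otimes>\<^sub>M lebesgue))"

definition Per_s :: "real \<Rightarrow> 'b::euclidean_space set \<Rightarrow> 'b set \<Rightarrow> ennreal" where
  "Per_s s E U = Ls s (E \<inter> U) (- E \<inter> U) + Ls s (E \<inter> U) (- E \<inter> - U)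
                 + Ls s (E \<inter> - U) (- E \<inter> U)"

definition s_minimal_bdd :: "real \<Rightarrow> 'b::euclidean_space set \<Rightarrow> 'b set \<Rightarrow> bool" where
  "s_minimal_bdd s E U \<longleftrightarrow> E \<in> sets lebesgue \<and> Per_s s E U < \<infinity> \<and>
     (\<forall>F \<in> sets lebesgue. F - U = E - U \<longrightarrow> Per_s s E U \<le> Per_s s F U)"

definition s_minimal :: "real \<Rightarrow> 'b::euclidean_space set \<Rightarrow> 'b set \<Rightarrow> bool" where
  "s_minimal s E \<Omega> \<longleftrightarrow> E \<in> sets lebesgue \<and>
     (\<forall>U. open U \<and> bounded U \<and> U \<subseteq> \<Omega> \<longrightarrow> s_minimal_bdd s E U)"

definition lipschitz_boundary :: "'b::euclidean_space set \<Rightarrow> bool" where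
  "lipschitz_boundary U \<longleftrightarrow>
     (\<forall>p \<in> frontier U. \<exists>r>0. \<exists>e. norm e = 1 \<and> (\<exists>L g. L-lipschitz_on {y. y \<bullet> e = 0} g \<and>
        U \<inter> ball p r = {x \<in> ball p r. x \<bullet> e > g (x - (x \<bullet> e) *\<^sub>R e)}))"

text \<open>Standard measure-theoretic normalization of a set E inside an open set U:
  interior points (in the measure sense) belong to E, exterior ones do not.\<close>
definition normalized_in :: "'b::euclidean_space set \<Rightarrow> 'b set \<Rightarrow> bool" where
  "normalized_in E U \<longleftrightarrow> (\<forall>x \<in> U.
     ((\<exists>r>0. emeasure lebesgue (ball x r - E) = 0) \<longrightarrow> x \<in> E) \<and>
     ((\<exists>r>0. emeasure lebesgue (ball x r \<inter> E) = 0) \<longrightarrow> x \<notin> E))"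

definition Linfty_loc :: "('b::euclidean_space \<Rightarrow> real) \<Rightarrow> bool" where
  "Linfty_loc f \<longleftrightarrow> f \<in> borel_measurable lebesgue \<and>
     (\<forall>K. compact K \<longrightarrow> (\<exists>M. AE x in lebesgue. x \<in> K \<longrightarrow> \<bar>f x\<bar> \<le> M))"

end

theory Submission
  imports Defs
begin

text \<open>
  Above height $0$ and near the origin, $E$ lies inside $\<Omega>$, so at a height
  $h \<ge> \<epsilon>$ one may delete from $E$ the cap $A$ cut off by the parabola
  $q = x_n + M (x_{n+1} - h)^2 - \<delta> < 0$ and compare energies. The level sets of $q$
  calibrate this comparison: for $x \<in> A$, the set $\{q \<ge> q(x)\}$ is a half-space up to a
  parabolic layer of finite kernel mass, while the part of the half-space lying outside
  $\{x_n > c |x'|^{1+s}\}$ has kernel mass growing like $\log (1/\<delta>)$: each scale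
  $R = 8^{-k}$ above both $\<delta>^{1/(1+s)}$ and $\<delta>^{1/s}$ contributes the same amount. Hence, for small
  $\<delta>$, deleting $A$ strictly lowers the energy unless $A$ is a null set. Since the far
  field only enters through a constant, $\<delta>$ does not depend on $h$.
\<close>

text \<open>Two obstacles shape the argument. Minimality only tests changes inside bounded open
  sets, while the region x_n < \<delta> is unbounded in the vertical direction; bending the cut into
  a parabola closes it. The bending is affordable: at distance R a layer of thickness R^2 has volume
  of order R^(n+2), and against the kernel R^(-(n+1+s)) this leaves R^(1-s), summable over dyadic
  scales since s < 1. The same count for the gap between the wall and its tangent plane, of
  thickness R^(1+s), leaves R^0: the exponent 1+s is the largest for which the scales fail to sum,
  and a smaller \<beta> is reduced to it inside the unit ball. The other obstacle is the diagonal.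
  The kernel is not integrable there, so the curvature of a level set only makes sense as a
  principal value. All pointwise comparisons are therefore made with the kernel cut off at distance
  e, with constants independent of e, and the cutoff is removed by monotone convergence only after
  integration over the cap.\<close>

lemma sigma_finite_lebesgue: "sigma_finite_measure (lebesgue :: 'b::euclidean_space measure)"
proof -
  obtain A :: "'b set set" where A: "countable A" "A \<subseteq> sets lborel" "\<Union>A = space lborel"
      "\<forall>a\<in>A. emeasure lborel a \<noteq> \<infinity>"
    using lborel.sigma_finite_countable by (elim exE conjE) rule
  have "\<forall>a\<in>A. emeasure lebesgue a \<noteq> \<infinity>"
  proof
    fix a assume "a \<in> A"
    then show "emeasure lebesgue a \<noteq> \<infinity>"
      using A(2,4) subsetD[OF A(2)] by (simp add: sets_completionI_sets)
  qed
  moreover have "A \<subseteq> sets lebesgue"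
    using A(2) by (meson sets_completionI_sets subset_iff)
  moreover have "\<Union>A = space lebesgue"
    using A(3) by simp
  ultimately show ?thesis
    using A(1) by (intro sigma_finite_measure.intro exI[of _ A] conjI)
qed

lemma pair_sigma_finite_lebesgue:
  "pair_sigma_finite (lebesgue :: 'b::euclidean_space measure) (lebesgue :: 'c::euclidean_space measure)"
  by (simp add: pair_sigma_finite_def sigma_finite_lebesgue)

section \<open>The kernel and the interaction energy\<close>

definition kern :: "real \<Rightarrow> 'b::euclidean_space \<Rightarrow> ennreal" where
  "kern s v = ennreal (norm v powr (- (real DIM('b) + s)))"

lemma kern_measurable [measurable]: "kern s \<in> borel_measurable borel"
  unfolding kern_def by measurable

lemma kern_minus_commute: "kern s (x - y) = kern s (y - x)"
  by (simp add: kern_def norm_minus_commute)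

text \<open>The junk value $0^{-p} = 0$ makes the kernel vanish on the diagonal, so it is the
  supremum of its truncations everywhere.\<close>

lemma kern_zero [simp]: "kern s 0 = 0"
  by (simp add: kern_def)

lemma ident_measurable_lebesgue: "(\<lambda>x. x) \<in> lebesgue \<rightarrow>\<^sub>M borel"
  by (rule measurable_completion) simp

lemma fst_measurable_lebesgue_pair [measurable]: "fst \<in> lebesgue \<Otimes>\<^sub>M lebesgue \<rightarrow>\<^sub>M borel"
  by (rule measurable_compose[OF measurable_fst ident_measurable_lebesgue])

lemma snd_measurable_lebesgue_pair [measurable]: "snd \<in> lebesgue \<Otimes>\<^sub>M lebesgue \<rightarrow>\<^sub>M borel"
  by (rule measurable_compose[OF measurable_snd ident_measurable_lebesgue])

text \<open>Tonelli for two sigma-finite factors. Keeping \<open>indicator A x\<close> outside the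
  inner integral isolates the potential of \<open>B\<close> at \<open>x\<close>, which is the
  quantity that can be compared point by point.\<close>

lemma Ls_eq_iterated:
  fixes A B :: "'b::euclidean_space set"
  assumes [measurable]: "A \<in> sets lebesgue" "B \<in> sets lebesgue"
  shows "Ls s A B = (\<integral>\<^sup>+x. indicator A x * (\<integral>\<^sup>+y. indicator B y * kern s (x - y) \<partial>lebesgue) \<partial>lebesgue)"
proof -
  note ident_measurable_lebesgue [measurable]
  interpret pair_sigma_finite "lebesgue :: 'b measure" "lebesgue :: 'b measure"
    by (rule pair_sigma_finite_lebesgue)
  have "Ls s A B = (\<integral>\<^sup>+p. indicator (A \<times> B) p * kern s (fst p - snd p) \<partial>(lebesgue \<Otimes>\<^sub>M lebesgue))"
    by (simp add: Ls_def kern_def)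
  also have "\<dots> = (\<integral>\<^sup>+x. (\<integral>\<^sup>+y. indicator (A \<times> B) (x, y) * kern s (fst (x, y) - snd (x, y)) \<partial>lebesgue) \<partial>lebesgue)"
    by (rule sigma_finite_measure.nn_integral_fst[OF sigma_finite_lebesgue, symmetric]) measurable
  also have "\<dots> = (\<integral>\<^sup>+x. indicator A x * (\<integral>\<^sup>+y. indicator B y * kern s (x - y) \<partial>lebesgue) \<partial>lebesgue)"
    by (intro nn_integral_cong) (simp add: indicator_times mult.assoc nn_integral_cmult)
  finally show ?thesis .
qed

lemma Ls_eq_double:
  fixes A B :: "'b::euclidean_space set"
  assumes [measurable]: "A \<in> sets lebesgue" "B \<in> sets lebesgue"
  shows "Ls s A B = (\<integral>\<^sup>+x. \<integral>\<^sup>+y. indicator A x * (indicator B y * kern s (x - y)) \<partial>lebesgue \<partial>lebesgue)"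
proof -
  note ident_measurable_lebesgue [measurable]
  show ?thesis
    unfolding Ls_eq_iterated[OF assms] by (intro nn_integral_cong nn_integral_cmult[symmetric]) measurable
qed

lemma Ls_commute:
  fixes A B :: "'b::euclidean_space set"
  assumes [measurable]: "A \<in> sets lebesgue" "B \<in> sets lebesgue"
  shows "Ls s A B = Ls s B A"
proof -
  interpret pair_sigma_finite "lebesgue :: 'b measure" "lebesgue :: 'b measure"
    by (rule pair_sigma_finite_lebesgue)
  have "Ls s A B = (\<integral>\<^sup>+x. \<integral>\<^sup>+y. indicator A x * (indicator B y * kern s (x - y)) \<partial>lebesgue \<partial>lebesgue)"
    by (rule Ls_eq_double) fact+
  also have "\<dots> = (\<integral>\<^sup>+y. \<integral>\<^sup>+x. indicator A x * (indicator B y * kern s (x - y)) \<partial>lebesgue \<partial>lebesgue)"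
    by (rule Fubini'[symmetric]) measurable
  also have "\<dots> = (\<integral>\<^sup>+y. \<integral>\<^sup>+x. indicator B y * (indicator A x * kern s (y - x)) \<partial>lebesgue \<partial>lebesgue)"
    by (intro nn_integral_cong) (metis kern_minus_commute mult.left_commute)
  also have "\<dots> = Ls s B A"
    by (rule Ls_eq_double[symmetric]) fact+
  finally show ?thesis .
qed

lemma Ls_Un_left:
  fixes A B C :: "'b::euclidean_space set"
  assumes [measurable]: "A \<in> sets lebesgue" "B \<in> sets lebesgue" "C \<in> sets lebesgue" and "A \<inter> B = {}"
  shows "Ls s (A \<union> B) C = Ls s A C + Ls s B C"
proof -
  note ident_measurable_lebesgue [measurable]
  interpret sigma_finite_measure "lebesgue :: 'b measure"
    by (rule sigma_finite_lebesgue)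
  let ?f = "\<lambda>x. \<integral>\<^sup>+y. indicator C y * kern s (x - y) \<partial>lebesgue"
  have "?f \<in> borel_measurable lebesgue"
    by measurable
  then have "(\<integral>\<^sup>+x. indicator A x * ?f x + indicator B x * ?f x \<partial>lebesgue) =
      (\<integral>\<^sup>+x. indicator A x * ?f x \<partial>lebesgue) + (\<integral>\<^sup>+x. indicator B x * ?f x \<partial>lebesgue)"
    by (intro nn_integral_add) measurable
  moreover have "indicator (A \<union> B) x * ?f x = indicator A x * ?f x + indicator B x * ?f x" for x
    using \<open>A \<inter> B = {}\<close> by (auto simp: indicator_def)
  ultimately show ?thesis
    by (simp add: Ls_eq_iterated)
qed

lemma Ls_Un_right:
  fixes A B C :: "'b::euclidean_space set"
  assumes "A \<in> sets lebesgue" "B \<in> sets lebesgue" "C \<in> sets lebesgue" and "A \<inter> B = {}"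
  shows "Ls s C (A \<union> B) = Ls s C A + Ls s C B"
  using assms by (simp add: Ls_commute[of C] Ls_Un_left)

section \<open>Energy balance for deleting a set\<close>

text \<open>Passing from \<open>E\<close> to \<open>E - A\<close> changes only the interactions that
  involve \<open>A\<close>: those with the complement of \<open>E\<close> disappear, those with the
  rest of \<open>E\<close> appear. All other terms are common to both perimeters and finite, hence
  cancel. The finiteness claim is recorded because the final contradiction subtracts this
  energy.\<close>

lemma s_minimal_bdd_delete:
  fixes E U A :: "'b::euclidean_space set"
  assumes min: "s_minimal_bdd s E U" and U: "U \<in> sets lebesgue"
    and A: "A \<in> sets lebesgue" "A \<subseteq> E \<inter> U"
  shows "Ls s A (- E) \<le> Ls s A (E - A)" "Ls s A (- E) < \<infinity>"
proof -
  have E: "E \<in> sets lebesgue" using min by (simp add: s_minimal_bdd_def)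
  have compl: "- X \<in> sets lebesgue" if "X \<in> sets lebesgue" for X :: "'b set"
    using sets.compl_sets[OF that] by (simp add: Compl_eq_Diff_UNIV)
  define B N Q D where "B = E \<inter> U - A" and "N = - E \<inter> U" and "Q = - E \<inter> - U" and "D = E \<inter> - U"
  have m: "A \<in> sets lebesgue" "B \<in> sets lebesgue" "N \<in> sets lebesgue" "Q \<in> sets lebesgue" "D \<in> sets lebesgue"
    using E U A compl by (auto simp: B_def N_def Q_def D_def)
  have mU: "N \<union> A \<in> sets lebesgue" using m by auto
  have dis: "A \<inter> B = {}" "N \<inter> A = {}" "B \<inter> D = {}" "N \<inter> Q = {}" "B \<inter> N = {}"
    using A by (auto simp: B_def N_def Q_def D_def)
  have "E \<inter> U = A \<union> B" using A by (auto simp: B_def)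
  then have perE: "Per_s s E U = (Ls s A N + Ls s B N) + (Ls s A Q + Ls s B Q) + Ls s D N"
    using m dis by (simp add: Per_s_def Ls_Un_left flip: N_def Q_def D_def)
  define F where "F = E - A"
  have F: "F \<inter> U = B" "- F \<inter> U = N \<union> A" "- F \<inter> - U = Q" "F \<inter> - U = D"
    using A by (auto simp: F_def B_def N_def Q_def D_def)
  have perF: "Per_s s F U = (Ls s B N + Ls s B A) + Ls s B Q + (Ls s D N + Ls s D A)"
    using m dis mU by (simp add: Per_s_def F Ls_Un_right)
  have fin: "Per_s s E U < \<infinity>" using min by (simp add: s_minimal_bdd_def)
  have "F \<in> sets lebesgue" "F - U = E - U" using E A by (auto simp: F_def)
  then have le: "Per_s s E U \<le> Per_s s F U" using min by (simp add: s_minimal_bdd_def)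
  define Z where "Z = Ls s B N + Ls s B Q + Ls s D N"
  have Z: "Z < \<infinity>" using fin by (simp add: perE Z_def)
  have "Z + (Ls s A N + Ls s A Q) \<le> Z + (Ls s B A + Ls s D A)"
    using le by (simp add: perE perF Z_def ac_simps)
  then have 1: "Ls s A N + Ls s A Q \<le> Ls s B A + Ls s D A"
    using Z by (auto simp: ennreal_add_left_cancel_le)
  have "- E = N \<union> Q" "E - A = B \<union> D" using A by (auto simp: B_def N_def Q_def D_def)
  then have 2: "Ls s A (- E) = Ls s A N + Ls s A Q" "Ls s A (E - A) = Ls s B A + Ls s D A"
    using m dis by (simp_all add: Ls_Un_right Ls_commute[of _ A])
  show "Ls s A (- E) \<le> Ls s A (E - A)" using 1 2 by simp
  show "Ls s A (- E) < \<infinity>" using fin by (simp add: 2 perE)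
qed

section \<open>The truncated kernel and the calibration argument\<close>

text \<open>The cutoff bounds the kernel, so a set of finite measure has finite truncated
  interaction with itself, and that interaction may be cancelled.\<close>

definition kern_cut :: "real \<Rightarrow> real \<Rightarrow> 'b::euclidean_space \<Rightarrow> ennreal" where
  "kern_cut s e v = indicator {v. e < norm v} v * kern s v"

lemma kern_cut_measurable [measurable]: "kern_cut s e \<in> borel_measurable borel"
  unfolding kern_cut_def by measurable

lemma kern_cut_minus_commute: "kern_cut s e (x - y) = kern_cut s e (y - x)"
  by (simp add: kern_cut_def kern_minus_commute[of s x y] norm_minus_commute indicator_def)

lemma kern_cut_le_kern: "kern_cut s e v \<le> kern s v"
  by (simp add: kern_cut_def indicator_def)

lemma kern_cut_le:
  fixes v :: "'b::euclidean_space"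
  assumes "0 < e" "0 < s"
  shows "kern_cut s e v \<le> ennreal (e powr (- (real DIM('b) + s)))"
  using assms by (auto simp: kern_cut_def kern_def indicator_def intro!: ennreal_leI powr_mono2')

lemma kern_eq_SUP_cut:
  assumes "0 < e"
  shows "kern s v = (SUP n. kern_cut s (e / real (Suc n)) v)"
proof (cases "v = 0")
  case True
  then show ?thesis by (simp add: kern_cut_def)
next
  case False
  then obtain n where n: "e / norm v < real (Suc n)"
    using reals_Archimedean2 by (meson less_trans lessI of_nat_less_iff)
  then have "kern_cut s (e / real (Suc n)) v = kern s v"
    using False by (simp add: kern_cut_def field_simps)
  then have "kern s v \<le> (SUP n. kern_cut s (e / real (Suc n)) v)"
    by (metis SUP_upper UNIV_I)
  then show ?thesis
    by (intro antisym SUP_least kern_cut_le_kern)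
qed

lemma incseq_kern_cut: 
  assumes "0 < e"
  shows "incseq (\<lambda>n. kern_cut s (e / real (Suc n)) v)"
proof (intro incseq_SucI)
  fix n
  have "e / real (Suc (Suc n)) \<le> e / real (Suc n)"
    using assms by (intro divide_left_mono) auto
  then show "kern_cut s (e / real (Suc n)) v \<le> kern_cut s (e / real (Suc (Suc n))) v"
    by (auto simp: kern_cut_def indicator_def)
qed

text \<open>The hypothesis says that the level set of $q$ through each $x \<in> A$ has positive truncated
  nonlocal mean curvature. Integrating it over $A$, the interactions of $A$ with itself
  cancel by symmetry of the kernel.\<close>

lemma calibration:
  fixes q :: "'b::euclidean_space \<Rightarrow> real" and A D N :: "'b set"
  assumes s: "0 < s" and q [measurable]: "q \<in> borel_measurable borel"
    and sets [measurable]: "A \<in> sets lebesgue" "D \<in> sets lebesgue" "N \<in> sets lebesgue"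
    and fin: "emeasure lebesgue A < \<infinity>" and disj: "A \<inter> D = {}" "A \<inter> N = {}" and \<eta>: "0 < \<eta>"
    and curv: "\<And>x e. x \<in> A \<Longrightarrow> 0 < e \<Longrightarrow> e \<le> \<eta> \<Longrightarrow>
      (\<integral>\<^sup>+y. indicator (D \<union> {y\<in>A. q x \<le> q y}) y * kern_cut s e (x - y) \<partial>lebesgue) + 1
      \<le> (\<integral>\<^sup>+y. indicator (N \<union> {y\<in>A. q y < q x}) y * kern_cut s e (x - y) \<partial>lebesgue)"
  shows "Ls s A D + emeasure lebesgue A \<le> Ls s A N"
proof -
  note ident_measurable_lebesgue [measurable]
  interpret sigma_finite_measure "lebesgue :: 'b measure"
    by (rule sigma_finite_lebesgue)
  interpret pair_sigma_finite "lebesgue :: 'b measure" "lebesgue :: 'b measure"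
    by (rule pair_sigma_finite_lebesgue)
  define I where "I e X = (\<integral>\<^sup>+x. indicator A x * (\<integral>\<^sup>+y. indicator X y * kern_cut s e (x - y) \<partial>lebesgue) \<partial>lebesgue)"
    for e and X :: "'b set"
  have cut: "I e D + emeasure lebesgue A \<le> Ls s A N" if e: "0 < e" "e \<le> \<eta>" for e
  proof -
    let ?k = "kern_cut s e :: 'b \<Rightarrow> ennreal"
    let ?g = "\<lambda>X x. \<integral>\<^sup>+y. indicator X y * ?k (x - y) \<partial>lebesgue"
    \<comment> \<open>Ties \<open>q x = q y\<close> are left out of \<open>hi\<close>. This only
      discards part of the left-hand side of \<open>curv\<close>, and it makes \<open>hi\<close> and
      \<open>lo\<close> mirror images under exchanging \<open>x\<close> and
      \<open>y\<close>.\<close>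
    define hi where "hi = (\<lambda>(x, y). indicator A x * (indicator A y * (if q x < q y then ?k (x - y) else 0)))"
    define lo where "lo = (\<lambda>(x, y). indicator A x * (indicator A y * (if q y < q x then ?k (x - y) else 0)))"
    define J where "J = (\<integral>\<^sup>+x. \<integral>\<^sup>+y. hi (x, y) \<partial>lebesgue \<partial>lebesgue)"
    have [measurable]: "hi \<in> borel_measurable (lebesgue \<Otimes>\<^sub>M lebesgue)" "lo \<in> borel_measurable (lebesgue \<Otimes>\<^sub>M lebesgue)"
      unfolding hi_def lo_def by measurable
    have J_lo: "J = (\<integral>\<^sup>+x. \<integral>\<^sup>+y. lo (x, y) \<partial>lebesgue \<partial>lebesgue)"
    proof -
      have "hi (y, x) = lo (x, y)" for x y
        by (simp add: hi_def lo_def mult.left_commute kern_cut_minus_commute)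
      moreover have "J = (\<integral>\<^sup>+y. \<integral>\<^sup>+x. hi (x, y) \<partial>lebesgue \<partial>lebesgue)"
        unfolding J_def by (rule Fubini'[symmetric]) measurable
      ultimately show ?thesis by simp
    qed
    \<comment> \<open>The only place where both the cutoff and the finite measure of
      \<open>A\<close> are needed: \<open>J\<close> occurs on both sides and has to be
      subtracted.\<close>
    have J_fin: "J < \<infinity>"
    proof -
      let ?C = "ennreal (e powr (- (real DIM('b) + s)))"
      have "J \<le> (\<integral>\<^sup>+x. \<integral>\<^sup>+y. ?C * indicator A x * indicator A y \<partial>lebesgue \<partial>lebesgue)"
        unfolding J_def hi_def using kern_cut_le[OF e(1) s]
        by (intro nn_integral_mono) (auto simp: indicator_def)
      also have "\<dots> = ?C * emeasure lebesgue A * emeasure lebesgue A"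
        by (simp add: nn_integral_cmult mult.commute mult.left_commute nn_integral_multc del: emeasure_completion)
      also have "\<dots> < \<infinity>"
        using fin by (simp add: ennreal_mult_less_top del: emeasure_completion)
      finally show ?thesis .
    qed
    have "I e D + J + emeasure lebesgue A = (\<integral>\<^sup>+x. indicator A x * ?g D x + (\<integral>\<^sup>+y. hi (x, y) \<partial>lebesgue) + indicator A x \<partial>lebesgue)"
      unfolding I_def J_def
      by (simp add: nn_integral_add del: emeasure_completion)
    also have "\<dots> \<le> (\<integral>\<^sup>+x. indicator A x * ?g N x + (\<integral>\<^sup>+y. lo (x, y) \<partial>lebesgue) \<partial>lebesgue)"
    proof (rule nn_integral_mono)
      fix x
      show "indicator A x * ?g D x + (\<integral>\<^sup>+y. hi (x, y) \<partial>lebesgue) + indicator A x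
          \<le> indicator A x * ?g N x + (\<integral>\<^sup>+y. lo (x, y) \<partial>lebesgue)"
      proof (cases "x \<in> A")
        case True
        have "?g D x + (\<integral>\<^sup>+y. hi (x, y) \<partial>lebesgue) = (\<integral>\<^sup>+y. indicator D y * ?k (x - y) + hi (x, y) \<partial>lebesgue)"
          by (intro nn_integral_add[symmetric]) measurable
        also have "\<dots> \<le> ?g (D \<union> {y\<in>A. q x \<le> q y}) x"
          using disj(1) by (intro nn_integral_mono) (auto simp: hi_def indicator_def)
        finally have 1: "?g D x + (\<integral>\<^sup>+y. hi (x, y) \<partial>lebesgue) \<le> ?g (D \<union> {y\<in>A. q x \<le> q y}) x" .
        have "?g (N \<union> {y\<in>A. q y < q x}) x \<le> (\<integral>\<^sup>+y. indicator N y * ?k (x - y) + lo (x, y) \<partial>lebesgue)"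
          using disj(2) True by (intro nn_integral_mono) (auto simp: lo_def indicator_def)
        also have "\<dots> = ?g N x + (\<integral>\<^sup>+y. lo (x, y) \<partial>lebesgue)"
          by (intro nn_integral_add) measurable
        finally have 2: "?g (N \<union> {y\<in>A. q y < q x}) x \<le> ?g N x + (\<integral>\<^sup>+y. lo (x, y) \<partial>lebesgue)" .
        have "?g D x + (\<integral>\<^sup>+y. hi (x, y) \<partial>lebesgue) + 1 \<le> ?g (D \<union> {y\<in>A. q x \<le> q y}) x + 1"
          using 1 by (rule add_right_mono)
        also have "\<dots> \<le> ?g (N \<union> {y\<in>A. q y < q x}) x"
          by (rule curv[OF True e])
        also note 2
        finally show ?thesis using True by simp
      qed (simp add: hi_def)
    qed
    also have "\<dots> = I e N + J"
      unfolding I_def J_lo by (simp add: nn_integral_add)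
    finally have "J + (I e D + emeasure lebesgue A) \<le> J + I e N"
      by (simp add: ac_simps del: emeasure_completion)
    then have "I e D + emeasure lebesgue A \<le> I e N"
      using J_fin by (auto simp: ennreal_add_left_cancel_le simp del: emeasure_completion)
    also have "I e N \<le> Ls s A N"
      unfolding I_def Ls_eq_iterated[OF sets(1,3)]
      by (intro nn_integral_mono mult_left_mono kern_cut_le_kern) auto
    finally show ?thesis .
  qed
  \<comment> \<open>Only the \<open>D\<close> side has to pass to the limit; on the \<open>N\<close>
    side the truncated interaction has already been bounded by \<open>Ls s A N\<close>.\<close>
  define r where "r n = \<eta> / real (Suc n)" for n
  have r: "0 < r n" "r n \<le> \<eta>" for n
    using \<eta> by (auto simp: r_def field_simps)
  have inner: "(\<integral>\<^sup>+y. indicator D y * kern s (x - y) \<partial>lebesgue)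
      = (SUP n. \<integral>\<^sup>+y. indicator D y * kern_cut s (r n) (x - y) \<partial>lebesgue)" for x
  proof -
    have "(\<integral>\<^sup>+y. indicator D y * kern s (x - y) \<partial>lebesgue)
        = (\<integral>\<^sup>+y. (SUP n. indicator D y * kern_cut s (r n) (x - y)) \<partial>lebesgue)"
      unfolding r_def kern_eq_SUP_cut[OF \<eta>, of s] by (simp add: SUP_mult_left_ennreal)
    also have "\<dots> = (SUP n. \<integral>\<^sup>+y. indicator D y * kern_cut s (r n) (x - y) \<partial>lebesgue)"
      unfolding r_def
      by (intro nn_integral_monotone_convergence_SUP)
         (auto simp: incseq_def le_fun_def simp del: of_nat_Suc intro!: mult_left_mono incseqD[OF incseq_kern_cut[OF \<eta>]])
    finally show ?thesis .
  qed
  have "Ls s A D = (\<integral>\<^sup>+x. (SUP n. indicator A x * (\<integral>\<^sup>+y. indicator D y * kern_cut s (r n) (x - y) \<partial>lebesgue)) \<partial>lebesgue)"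
    by (simp add: Ls_eq_iterated inner SUP_mult_left_ennreal)
  also have "\<dots> = (SUP n. I (r n) D)"
    unfolding I_def r_def
    by (intro nn_integral_monotone_convergence_SUP)
       (auto simp: incseq_def le_fun_def simp del: of_nat_Suc intro!: mult_left_mono nn_integral_mono incseqD[OF incseq_kern_cut[OF \<eta>]])
  finally have "Ls s A D + emeasure lebesgue A = (SUP n. I (r n) D + emeasure lebesgue A)"
    by (simp add: ennreal_SUP_add_left del: emeasure_completion)
  also have "\<dots> \<le> Ls s A N"
    using cut[OF r] by (intro SUP_least)
  finally show ?thesis .
qed

section \<open>Kernel mass by dyadic shells, and the far field\<close>

text \<open>The Jacobian is 1. The case \<open>c = 1\<close> recentres at a point,
  \<open>c = - 1\<close> is the point reflection that exchanges the two sides of a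
  half-space.\<close>

lemma nn_integral_lborel_affine:
  fixes f :: "'b::euclidean_space \<Rightarrow> ennreal"
  assumes [measurable]: "f \<in> borel_measurable borel" and c: "\<bar>c\<bar> = 1"
  shows "(\<integral>\<^sup>+x. f (t + c *\<^sub>R x) \<partial>lborel) = (\<integral>\<^sup>+x. f x \<partial>lborel)"
proof -
  have "c \<noteq> 0" using c by auto
  then have eq: "lborel = density (distr lborel borel (\<lambda>x. t + c *\<^sub>R x)) (\<lambda>_. 1)"
    using lborel_affine[of c t] c by simp
  show ?thesis
    by (subst (2) eq) (simp add: nn_integral_density nn_integral_distr density_1)
qed

text \<open>On \<open>Y k\<close> the kernel is at most its value at the inner radius
  \<open>l k\<close>, and \<open>V k\<close> bounds the volume. The pieces may overlap, since only
  an upper bound is wanted, and the origin may be left uncovered because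
  \<open>kern s 0 = 0\<close>.\<close>

lemma kern_mass_le_suminf:
  fixes Z :: "'b::euclidean_space set"
  assumes s: "0 < s" and Z: "Z \<subseteq> insert 0 (\<Union>k::nat. Y k)"
    and Y: "\<And>k. Y k \<in> sets borel" "\<And>k v. v \<in> Y k \<Longrightarrow> l k \<le> norm v" "\<And>k. 0 < l k"
    and V: "\<And>k. emeasure lborel (Y k) \<le> ennreal (V k)" "\<And>k. 0 \<le> V k"
    and sums: "(\<lambda>k. l k powr (- (real DIM('b) + s)) * V k) sums B"
  shows "(\<integral>\<^sup>+v. indicator Z v * kern s v \<partial>lborel) \<le> ennreal B"
proof -
  let ?p = "\<lambda>k. l k powr (- (real DIM('b) + s))"
  have "(\<integral>\<^sup>+v. indicator Z v * kern s v \<partial>lborel) \<le> (\<integral>\<^sup>+v. (\<Sum>k. ennreal (?p k) * indicator (Y k) v) \<partial>lborel)"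
  proof (rule nn_integral_mono)
    fix v
    show "indicator Z v * kern s v \<le> (\<Sum>k. ennreal (?p k) * indicator (Y k) v)"
    proof (cases "v \<in> Z \<and> v \<noteq> 0")
      case True
      then obtain k where k: "v \<in> Y k" using Z by auto
      have "kern s v \<le> ennreal (?p k)"
        unfolding kern_def using Y(2)[OF k] Y(3)[of k] s by (intro ennreal_leI powr_mono2') auto
      also have "\<dots> = (\<Sum>j\<in>{k}. ennreal (?p j) * indicator (Y j) v)"
        using k by simp
      also have "\<dots> \<le> (\<Sum>j. ennreal (?p j) * indicator (Y j) v)"
        by (rule sum_le_suminf) auto
      finally show ?thesis using True by simp
    qed auto
  qed
  also have "\<dots> = (\<Sum>k. ennreal (?p k) * emeasure lborel (Y k))"
    using Y(1) by (simp add: nn_integral_suminf nn_integral_cmult_indicator)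
  also have "\<dots> \<le> (\<Sum>k. ennreal (?p k * V k))"
    using V by (intro suminf_le) (auto simp: ennreal_mult intro!: mult_left_mono)
  also have "\<dots> = ennreal B"
    using sums V(2) by (intro suminf_ennreal_eq) auto
  finally show ?thesis .
qed

text \<open>From one shell to the next the radius doubles, so the volume bound grows by 2^n and the
  kernel shrinks by 2^(-(n+s)), n being the full dimension. The series is geometric with ratio
  2^(-s); \<open>c\<close> is the bound for the innermost shell.\<close>

lemma kern_mass_tail:
  fixes r s :: real
  assumes s: "0 < s" and r: "0 < r"
  shows "\<exists>B\<ge>0. (\<integral>\<^sup>+v. indicator {v::'b::euclidean_space. r \<le> norm v} v * kern s v \<partial>lborel) \<le> ennreal B"
proof -
  define n where "n = DIM('b)"
  define q where "q = 2 powr (- s)"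
  define c where "c = r powr (- (real n + s)) * (unit_ball_vol n * (2 * r) ^ n)"
  have q: "0 < q" "q < 1" using s by (auto simp: q_def powr_less_one)
  have "(\<lambda>k. c * q ^ k) sums (c * (1 / (1 - q)))"
    using q by (intro sums_mult geometric_sums) auto
  moreover have "(2 ^ k * r) powr (- (real n + s)) * (unit_ball_vol n * (2 * (2 ^ k * r)) ^ n) = c * q ^ k" for k
  proof -
    have 1: "(2 ^ k) powr (- (real n + s)) * (2 ^ k) ^ n = q ^ k" 
    proof -
      have "((2::real) ^ k) ^ n = (2 ^ k) powr real n" by (simp add: powr_realpow)
      then have "((2::real) ^ k) powr (- (real n + s)) * (2 ^ k) ^ n = (2 ^ k) powr (- s)"
        by (simp add: powr_add[symmetric])
      also have "\<dots> = q ^ k"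
        by (simp add: q_def powr_realpow[symmetric] powr_powr mult.commute)
      finally show ?thesis .
    qed
    have "(2 ^ k * r) powr (- (real n + s)) * (unit_ball_vol n * (2 * (2 ^ k * r)) ^ n)
        = ((2 ^ k) powr (- (real n + s)) * (2 ^ k) ^ n) * c"
      using r by (simp add: powr_mult power_mult_distrib c_def mult_ac)
    also have "\<dots> = c * q ^ k"
      unfolding 1 by (rule mult.commute)
    finally show ?thesis .
  qed
  ultimately have sums: "(\<lambda>k. (2 ^ k * r) powr (- (real DIM('b) + s)) * (unit_ball_vol n * (2 * (2 ^ k * r)) ^ n))
      sums (c * (1 / (1 - q)))"
    by (simp add: n_def)
  have "(\<integral>\<^sup>+v. indicator {v::'b. r \<le> norm v} v * kern s v \<partial>lborel) \<le> ennreal (c * (1 / (1 - q)))"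
  proof (rule kern_mass_le_suminf[OF s _ _ _ _ _ _ sums])
    let ?Y = "\<lambda>k. {v::'b. 2 ^ k * r \<le> norm v \<and> norm v \<le> 2 * (2 ^ k * r)}"
    show "{v::'b. r \<le> norm v} \<subseteq> insert 0 (\<Union>k. ?Y k)"
    proof
      fix v :: 'b assume v: "v \<in> {v. r \<le> norm v}"
      define x where "x = norm v / r"
      have x: "1 \<le> x" using v r by (simp add: x_def)
      obtain m :: nat where "x < 2 ^ m" using real_arch_pow[of 2 x] by auto
      then have ex: "\<exists>m. x < 2 ^ m" by blast
      define m0 where "m0 = (LEAST m. x < 2 ^ m)"
      have m0: "x < 2 ^ m0" unfolding m0_def using ex by (rule LeastI_ex)
      then have "m0 \<noteq> 0" using x by (metis not_less power_0)
      then obtain k where k: "m0 = Suc k" by (cases m0) auto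
      have "\<not> x < 2 ^ k" using not_less_Least[of k "\<lambda>m. x < 2 ^ m"] k by (simp add: m0_def)
      then have "v \<in> ?Y k" using m0 k r by (auto simp: x_def field_simps)
      then show "v \<in> insert 0 (\<Union>k. ?Y k)" by blast
    qed
    show "emeasure lborel (?Y k) \<le> ennreal (unit_ball_vol n * (2 * (2 ^ k * r)) ^ n)" for k
    proof -
      have "emeasure lborel (?Y k) \<le> emeasure lborel (cball (0::'b) (2 * (2 ^ k * r)))"
        by (intro emeasure_mono) auto
      then show ?thesis using r by (simp add: emeasure_cball n_def)
    qed
  qed (use r in auto)
  moreover have "0 \<le> c * (1 / (1 - q))" using q r by (auto simp: c_def)
  ultimately show ?thesis by blast
qed

lemma snd_fst_measurable_borel [measurable]:
  "(\<lambda>v :: ('a::euclidean_space \<times> real) \<times> real. snd (fst v)) \<in> borel_measurable borel"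
  by (intro borel_measurable_continuous_onI continuous_intros)

lemma snd_measurable_borel [measurable]:
  "(\<lambda>v :: 'a::euclidean_space \<times> real. snd v) \<in> borel_measurable borel"
  by (intro borel_measurable_continuous_onI continuous_intros)

section \<open>Layers along the boundary of a half-space\<close>

lemma emeasure_lborel_slices:
  fixes T :: "('a::euclidean_space \<times> 'b::euclidean_space) set"
  assumes "T \<in> sets borel"
  shows "emeasure lborel T = (\<integral>\<^sup>+z. emeasure lborel ((\<lambda>x. (x, z)) -` T) \<partial>lborel)"
proof -
  have "T \<in> sets (lborel \<Otimes>\<^sub>M lborel)"
    unfolding lborel_prod sets_lborel by (rule assms)
  from lborel_pair.emeasure_pair_measure_alt2[OF this] show ?thesis
    unfolding lborel_prod .
qed

text \<open>Freezing \<open>snd v\<close> turns the slab condition into an interval of length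
  \<open>h\<close> for \<open>snd (fst v)\<close>. The slope \<open>m\<close> merely translates this
  interval, so the bound is uniform in the tilt.\<close>

lemma emeasure_thin_layer_le:
  fixes m R h :: real
  assumes "0 \<le> R" "0 \<le> h"
  shows "emeasure lborel {v :: ('a::euclidean_space \<times> real) \<times> real.
      norm v < R \<and> - h \<le> snd (fst v) + m * snd v \<and> snd (fst v) + m * snd v \<le> 0}
    \<le> ennreal (unit_ball_vol (real DIM('a)) * R ^ DIM('a) * h * (2 * R))"
    (is "emeasure lborel ?T \<le> _")
proof -
  define c where "c = unit_ball_vol (real DIM('a)) * R ^ DIM('a) * h"
  have c: "0 \<le> c" using assms by (simp add: c_def)
  have T: "?T \<in> sets borel" by measurable
  have "emeasure lborel ?T = (\<integral>\<^sup>+z. emeasure lborel ((\<lambda>x. (x, z)) -` ?T) \<partial>lborel)"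
    by (rule emeasure_lborel_slices[OF T])
  also have "\<dots> \<le> (\<integral>\<^sup>+z. ennreal c * indicator {-R..R} z \<partial>lborel)"
  proof (rule nn_integral_mono)
    fix z :: real
    let ?B = "ball (0::'a) R \<times> {- m * z - h .. - m * z}"
    show "emeasure lborel ((\<lambda>x. (x, z)) -` ?T) \<le> ennreal c * indicator {-R..R} z"
    proof (cases "z \<in> {-R..R}")
      case True
      have "(\<lambda>x. (x, z)) -` ?T \<subseteq> ?B"
      proof
        fix x assume x: "x \<in> (\<lambda>x. (x, z)) -` ?T"
        have "norm (fst x) \<le> norm (x, z)"
          using norm_fst_le[of "fst x" "snd x"] norm_fst_le[of x z] by simp
        then show "x \<in> ?B" using x by (cases x) auto
      qed
      then have "emeasure lborel ((\<lambda>x. (x, z)) -` ?T) \<le> emeasure lborel ?B"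
        by (intro emeasure_mono) (simp_all add: borel_Times)
      also have "\<dots> = emeasure lborel (ball (0::'a) R) * emeasure lborel {- m * z - h .. - m * z}"
        unfolding lborel_prod[symmetric] by (rule lborel.emeasure_pair_measure_Times) auto
      also have "\<dots> = ennreal c"
        using assms by (simp add: emeasure_ball c_def ennreal_mult)
      finally show ?thesis using True by simp
    next
      case False
      have "(\<lambda>x. (x, z)) -` ?T = {}"
      proof -
        have "R < \<bar>z\<bar>" using False by (auto simp: abs_if)
        then have "\<not> norm (x, z) < R" for x :: "'a \<times> real"
          using norm_snd_le[of z x] by simp
        then show ?thesis by auto
      qed
      then show ?thesis by (simp only: emeasure_empty zero_le)
    qed
  qed
  also have "\<dots> = ennreal (c * (2 * R))"
    using assms c by (simp add: nn_integral_cmult_indicator ennreal_mult)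
  finally show ?thesis by (simp add: c_def)
qed

text \<open>Inside the ball of radius \<open>R k\<close> the layer is at most
  \<open>(R k)\<^sup>2\<close> thick, because \<open>M\<close> \<le> 1. Its volume is thus of order
  R^(n+3) in dimension n+2, leaving R^(1-s) per shell and a geometric series with ratio 2^(s-1). One
  \<open>B\<close> serves all slopes, so it does not depend on the point of the cap where the
  tangent is taken.\<close>

lemma kern_mass_parabolic_layer:
  fixes r s :: real
  assumes s: "0 < s" "s < 1" and r: "0 < r"
  shows "\<exists>B\<ge>0. \<forall>m M. 0 \<le> M \<longrightarrow> M \<le> 1 \<longrightarrow>
    (\<integral>\<^sup>+v. indicator {v :: ('a::euclidean_space \<times> real) \<times> real. norm v < r
        \<and> - M * (snd v)\<^sup>2 \<le> snd (fst v) + m * snd v \<and> snd (fst v) + m * snd v \<le> 0} v * kern s v \<partial>lborel) \<le> ennreal B"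
proof -
  define n where "n = DIM('a)"
  have dim: "DIM(('a \<times> real) \<times> real) = n + 2" by (simp add: n_def)
  define q where "q = 2 powr (s - 1)"
  \<comment> \<open>The power of 2 arises because the kernel is evaluated at the inner radius
    \<open>l k\<close>, half of the radius \<open>R k\<close> that enters the volume.\<close>
  define c where "c = 2 powr (real n + 2 + s) * (2 * unit_ball_vol n) * r powr (1 - s)"
  have q: "0 < q" "q < 1" using s by (auto simp: q_def powr_less_one)
  define R where "R k = (1/2) ^ k * r" for k
  have R: "0 < R k" for k using r by (simp add: R_def)
  define l where "l k = R k / 2" for k
  define V where "V k = unit_ball_vol n * R k ^ n * (R k)\<^sup>2 * (2 * R k)" for k
  have "(\<lambda>k. c * q ^ k) sums (c * (1 / (1 - q)))"
    using q by (intro sums_mult geometric_sums) auto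
  moreover have "l k powr (- (real (n + 2) + s)) * V k = c * q ^ k" for k
  proof -
    have "V k = 2 * unit_ball_vol n * R k powr (real n + 3)"
      using R[of k] by (simp add: V_def powr_add powr_realpow power2_eq_square power3_eq_cube mult_ac)
    moreover have "l k powr (- (real (n + 2) + s)) = 2 powr (real n + 2 + s) * R k powr (- (real n + 2 + s))"
    proof -
      have "real (n + 2) = real n + 2" by simp
      then have "l k powr (- (real (n + 2) + s)) = R k powr (- (real n + 2 + s)) * (1 / 2 powr (- (real n + 2 + s)))"
        using R[of k] by (simp only: l_def powr_divide less_imp_le zero_le_numeral times_divide_eq_right mult_1_right)
      also have "1 / 2 powr (- (real n + 2 + s)) = 2 powr (real n + 2 + s)"
        by (simp only: powr_minus inverse_eq_divide divide_divide_eq_right mult_1 div_by_1)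
      finally show ?thesis by simp
    qed
    ultimately have "l k powr (- (real (n + 2) + s)) * V k
        = 2 powr (real n + 2 + s) * (2 * unit_ball_vol n) * (R k powr (- (real n + 2 + s)) * R k powr (real n + 3))"
      by simp
    also have "R k powr (- (real n + 2 + s)) * R k powr (real n + 3) = R k powr (1 - s)"
      by (simp add: powr_add[symmetric])
    also have "R k powr (1 - s) = q ^ k * r powr (1 - s)"
    proof -
      have "(1/2::real) ^ k = 2 powr (- real k)"
        by (simp add: powr_minus powr_realpow power_one_over inverse_eq_divide)
      then have "((1/2::real) ^ k) powr (1 - s) = 2 powr (real k * (s - 1))"
        by (simp add: powr_powr algebra_simps)
      also have "\<dots> = q ^ k"
        by (simp add: q_def powr_realpow[symmetric] powr_powr mult.commute)
      finally have "((1/2::real) ^ k) powr (1 - s) = q ^ k" .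
      then show ?thesis using r by (simp add: R_def powr_mult)
    qed
    finally show ?thesis by (simp add: c_def mult_ac)
  qed
  ultimately have sums: "(\<lambda>k. l k powr (- (real DIM(('a \<times> real) \<times> real) + s)) * V k) sums (c * (1 / (1 - q)))"
    by (simp only: dim)
  have "(\<integral>\<^sup>+v. indicator {v :: ('a \<times> real) \<times> real. norm v < r
        \<and> - M * (snd v)\<^sup>2 \<le> snd (fst v) + m * snd v \<and> snd (fst v) + m * snd v \<le> 0} v * kern s v \<partial>lborel)
      \<le> ennreal (c * (1 / (1 - q)))" if M: "0 \<le> M" "M \<le> 1" for m M
  proof (rule kern_mass_le_suminf[OF s(1) _ _ _ _ _ _ sums])
    let ?Y = "\<lambda>k. {v :: ('a \<times> real) \<times> real. (norm v < R k
        \<and> - M * (snd v)\<^sup>2 \<le> snd (fst v) + m * snd v \<and> snd (fst v) + m * snd v \<le> 0) \<and> l k \<le> norm v}"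
    show "{v :: ('a \<times> real) \<times> real. norm v < r
        \<and> - M * (snd v)\<^sup>2 \<le> snd (fst v) + m * snd v \<and> snd (fst v) + m * snd v \<le> 0} \<subseteq> insert 0 (\<Union>k. ?Y k)"
    proof
      fix v :: "('a \<times> real) \<times> real" 
      assume v: "v \<in> {v. norm v < r
        \<and> - M * (snd v)\<^sup>2 \<le> snd (fst v) + m * snd v \<and> snd (fst v) + m * snd v \<le> 0}"
      show "v \<in> insert 0 (\<Union>k. ?Y k)"
      proof (cases "v = 0")
        case False
        define x where "x = norm v / r"
        have x: "0 < x" "x < 1" using v r False by (auto simp: x_def)
        obtain k0 :: nat where "(1/2) ^ k0 < x" using real_arch_pow_inv[of x "1/2"] x by auto
        then have ex: "\<exists>k. (1/2) ^ k \<le> x" by (meson less_imp_le)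
        define m0 where "m0 = (LEAST m. (1/2) ^ m \<le> x)"
        have m0: "(1/2) ^ m0 \<le> x" unfolding m0_def using ex by (rule LeastI_ex)
        then have "m0 \<noteq> 0" using x by (metis not_less power_0)
        then obtain k where k: "m0 = Suc k" by (cases m0) auto
        have "\<not> (1/2) ^ k \<le> x" using not_less_Least[of k "\<lambda>m. (1/2) ^ m \<le> x"] k by (simp add: m0_def)
        then have "norm v < R k" "l k \<le> norm v"
          using m0 k r by (auto simp: x_def l_def R_def field_simps)
        then have "v \<in> ?Y k" using v by auto
        then show ?thesis by blast
      qed simp
    qed
    show "emeasure lborel (?Y k) \<le> ennreal (V k)" for k
    proof -
      have "emeasure lborel (?Y k) \<le> emeasure lborel {v :: ('a \<times> real) \<times> real.
          norm v < R k \<and> - (R k)\<^sup>2 \<le> snd (fst v) + m * snd v \<and> snd (fst v) + m * snd v \<le> 0}"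
      proof (rule emeasure_mono)
        show "?Y k \<subseteq> {v :: ('a \<times> real) \<times> real.
          norm v < R k \<and> - (R k)\<^sup>2 \<le> snd (fst v) + m * snd v \<and> snd (fst v) + m * snd v \<le> 0}"
        proof
          fix v assume v: "v \<in> ?Y k"
          have "\<bar>snd v\<bar> \<le> R k" using norm_snd_le[of "snd v" "fst v"] v by auto
          then have "(snd v)\<^sup>2 \<le> (R k)\<^sup>2" by (rule abs_le_square_iff[THEN iffD1, OF order_trans]) simp
          then have "M * (snd v)\<^sup>2 \<le> 1 * (R k)\<^sup>2" using M by (intro mult_mono) auto
          then show "v \<in> {v :: ('a \<times> real) \<times> real.
            norm v < R k \<and> - (R k)\<^sup>2 \<le> snd (fst v) + m * snd v \<and> snd (fst v) + m * snd v \<le> 0}"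
            using v by auto
        qed
      qed simp
      also have "\<dots> \<le> ennreal (V k)"
        unfolding V_def n_def using R[of k] by (intro emeasure_thin_layer_le) auto
      finally show ?thesis .
    qed
    show "0 \<le> V k" for k using R[of k] by (simp add: V_def)
  qed (use R in \<open>auto simp: l_def\<close>)
  moreover have "0 \<le> c * (1 / (1 - q))" using q r by (auto simp: c_def)
  ultimately show ?thesis by blast
qed

text \<open>$H$ is a half-space and $T$ a layer at its boundary; $S$ is the part of $H$ that $x + H$
  loses against $P$, and $W$ the far field. Comparing $P$ and $Q$ with $x + H$ and $x - H$,
  the (possibly huge) masses of $H$ and $-H$ cancel, while $S$ counts twice.\<close>

lemma kern_cut_mass_excess:
  fixes H T S W P Q :: "'b::euclidean_space set" and x :: 'b
  assumes sets [measurable]: "H \<in> sets borel" "T \<in> sets borel" "S \<in> sets borel" "W \<in> sets borel"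
      "P \<in> sets lebesgue" "Q \<in> sets lebesgue"
    and SH: "S \<subseteq> H" and anti: "\<And>v. v \<in> S \<Longrightarrow> - v \<notin> H"
    and P: "\<And>y. y \<in> P \<Longrightarrow> y - x \<in> (H - S) \<union> T \<union> W"
    and Q: "\<And>y. y - x \<in> S \<Longrightarrow> y \<in> Q" "\<And>y. x - y \<in> H \<Longrightarrow> y - x \<notin> T \<Longrightarrow> y \<in> Q"
    and T: "(\<integral>\<^sup>+v. indicator T v * kern s v \<partial>lborel) \<le> ennreal BT" "0 \<le> BT"
    and W: "(\<integral>\<^sup>+v. indicator W v * kern s v \<partial>lborel) \<le> ennreal BW" "0 \<le> BW"
    and S: "ennreal (BT + BT + BW + 1) \<le> (\<integral>\<^sup>+v. indicator S v * kern_cut s e v \<partial>lborel)"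
  shows "(\<integral>\<^sup>+y. indicator P y * kern_cut s e (x - y) \<partial>lebesgue) + 1
      \<le> (\<integral>\<^sup>+y. indicator Q y * kern_cut s e (x - y) \<partial>lebesgue)"
proof -
  let ?k = "kern_cut s e :: 'b \<Rightarrow> ennreal"
  define \<mu> where "\<mu> Z = (\<integral>\<^sup>+v. indicator Z v * ?k v \<partial>lborel)" for Z
  define \<nu> where "\<nu> Z = (\<integral>\<^sup>+y. indicator Z y * ?k (x - y) \<partial>lebesgue)" for Z
  have \<mu>: "\<mu> Z = (\<integral>\<^sup>+y. indicator Z (y - x) * ?k (x - y) \<partial>lebesgue)" if [measurable]: "Z \<in> sets borel" for Z
    unfolding \<mu>_def nn_integral_completion kern_cut_minus_commute[of s e x]
    using nn_integral_lborel_affine[of "\<lambda>v. indicator Z v * ?k v" 1 "- x"] by simp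
  \<comment> \<open>Reflection through \<open>x\<close> expresses the same mass by the opposite
    half-space; this is how the two half-spaces come to balance.\<close>
  have \<mu>H: "\<mu> H = (\<integral>\<^sup>+y. indicator H (x - y) * ?k (x - y) \<partial>lebesgue)"
    unfolding \<mu>_def nn_integral_completion
    using nn_integral_lborel_affine[of "\<lambda>v. indicator H v * ?k v" "- 1" x] by simp
  have k: "(\<lambda>y. ?k (x - y)) \<in> borel_measurable lborel"
    by (rule measurable_compose[OF _ kern_cut_measurable]) simp
  have m [measurable]: "(\<lambda>y. indicator Z (y - x) * ?k (x - y)) \<in> borel_measurable lebesgue"
    if Z: "Z \<in> sets borel" for Z
    using Z by (intro measurable_completion borel_measurable_times k
        measurable_compose[OF _ borel_measurable_indicator[of Z borel]]) simp_all
  have mH [measurable]: "(\<lambda>y. indicator H (x - y) * ?k (x - y)) \<in> borel_measurable lebesgue"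
    using sets(1) by (intro measurable_completion borel_measurable_times k
        measurable_compose[OF _ borel_measurable_indicator[of H borel]]) simp_all
  have mk [measurable]: "(\<lambda>y. ?k (x - y)) \<in> borel_measurable lebesgue"
    by (rule measurable_completion[OF k])
  \<comment> \<open>Near \<open>x\<close>, up to \<open>T\<close>, the set \<open>P\<close> avoids
    the translate of \<open>S\<close>, so \<open>S\<close> can be added to it without exceeding
    \<open>H\<close>.\<close>
  have 1: "\<nu> P + \<mu> S \<le> \<mu> H + \<mu> T + \<mu> W"
  proof -
    have "\<nu> P + \<mu> S = (\<integral>\<^sup>+y. indicator P y * ?k (x - y) + indicator S (y - x) * ?k (x - y) \<partial>lebesgue)"
      unfolding \<nu>_def \<mu>[OF sets(3)] by (intro nn_integral_add[symmetric]) measurable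
    also have "\<dots> \<le> (\<integral>\<^sup>+y. indicator H (y - x) * ?k (x - y) + indicator T (y - x) * ?k (x - y)
        + indicator W (y - x) * ?k (x - y) \<partial>lebesgue)"
    proof (rule nn_integral_mono)
      fix y
      have "(indicator P y + indicator S (y - x) :: ennreal) \<le> indicator H (y - x) + indicator T (y - x) + indicator W (y - x)"
        using P[of y] SH by (auto simp: indicator_def)
      from mult_right_mono[OF this, of "?k (x - y)"]
      show "indicator P y * ?k (x - y) + indicator S (y - x) * ?k (x - y)
        \<le> indicator H (y - x) * ?k (x - y) + indicator T (y - x) * ?k (x - y) + indicator W (y - x) * ?k (x - y)"
        by (simp add: distrib_right)
    qed
    also have "\<dots> = \<mu> H + \<mu> T + \<mu> W"
      unfolding \<mu>[OF sets(1)] \<mu>[OF sets(2)] \<mu>[OF sets(4)] by (simp add: nn_integral_add)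
    finally show ?thesis .
  qed
  \<comment> \<open>By \<open>anti\<close> the translate of \<open>S\<close> and the reflected copy
    of \<open>H\<close> are disjoint, and \<open>Q\<close> contains both up to
    \<open>T\<close>.\<close>
  have 2: "\<mu> H + \<mu> S \<le> \<nu> Q + \<mu> T"
  proof -
    have "\<mu> H + \<mu> S = (\<integral>\<^sup>+y. indicator H (x - y) * ?k (x - y) + indicator S (y - x) * ?k (x - y) \<partial>lebesgue)"
      unfolding \<mu>H \<mu>[OF sets(3)] by (intro nn_integral_add[symmetric]) measurable
    also have "\<dots> \<le> (\<integral>\<^sup>+y. indicator Q y * ?k (x - y) + indicator T (y - x) * ?k (x - y) \<partial>lebesgue)"
    proof (rule nn_integral_mono)
      fix y
      have "\<not> (x - y \<in> H \<and> y - x \<in> S)" using anti[of "y - x"] by auto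
      then have "(indicator H (x - y) + indicator S (y - x) :: ennreal) \<le> indicator Q y + indicator T (y - x)"
        using Q[of y] by (auto simp: indicator_def)
      from mult_right_mono[OF this, of "?k (x - y)"]
      show "indicator H (x - y) * ?k (x - y) + indicator S (y - x) * ?k (x - y)
          \<le> indicator Q y * ?k (x - y) + indicator T (y - x) * ?k (x - y)"
        by (simp add: distrib_right)
    qed
    also have "\<dots> = \<nu> Q + \<mu> T"
      unfolding \<nu>_def \<mu>[OF sets(2)] by (intro nn_integral_add) measurable
    finally show ?thesis .
  qed
  have le: "\<mu> Z \<le> (\<integral>\<^sup>+v. indicator Z v * kern s v \<partial>lborel)" for Z
    unfolding \<mu>_def by (intro nn_integral_mono mult_left_mono kern_cut_le_kern) auto
  have T': "\<mu> T \<le> ennreal BT" and W': "\<mu> W \<le> ennreal BW"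
    using le T W by (meson order_trans)+
  have \<mu>S: "\<mu> T + \<mu> T + \<mu> W + 1 \<le> \<mu> S"
  proof -
    have "\<mu> T + \<mu> T + \<mu> W + 1 \<le> ennreal BT + ennreal BT + ennreal BW + ennreal 1"
      using T' W' by (intro add_mono) auto
    also have "\<dots> = ennreal (BT + BT + BW + 1)"
      using T(2) W(2) by (simp only: ennreal_plus add_nonneg_nonneg zero_le_one)
    also have "\<dots> \<le> \<mu> S" using S by (simp add: \<mu>_def)
    finally show ?thesis .
  qed
  let ?X = "\<mu> T + \<mu> T + \<mu> W"
  have X: "?X \<noteq> top" using T' W' by (auto simp: top_unique)
  \<comment> \<open>The bounds are chained through \<open>\<mu> H\<close> instead of subtracting it,
    so only \<open>?X\<close> has to be finite. Of the two copies of \<open>\<mu> S\<close> one pays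
    for \<open>?X + 1\<close>; the other is given away in this inequality.\<close>
  have "?X + (\<nu> P + 1) \<le> \<mu> S + (?X + (\<nu> P + 1))"
    by (rule add_increasing[OF zero_le order_refl])
  also have "\<dots> = (?X + 1) + (\<nu> P + \<mu> S)" by (simp add: ac_simps)
  also have "\<dots> \<le> \<mu> S + (\<mu> H + \<mu> T + \<mu> W)"
    using \<mu>S 1 by (rule add_mono)
  also have "\<dots> = (\<mu> H + \<mu> S) + (\<mu> T + \<mu> W)" by (simp add: ac_simps)
  also have "\<dots> \<le> (\<nu> Q + \<mu> T) + (\<mu> T + \<mu> W)" using 2 by (rule add_right_mono)
  also have "\<dots> = ?X + \<nu> Q" by (simp add: ac_simps)
  finally have "?X + (\<nu> P + 1) \<le> ?X + \<nu> Q" .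
  then have "\<nu> P + 1 \<le> \<nu> Q"
    using X by (simp add: ennreal_add_left_cancel_le)
  then show ?thesis by (simp add: \<nu>_def)
qed

text \<open>For $b \<sim> R^{1+s}$ this box at distance about $R$ lies between the wall and its tangent
  half-space; its kernel mass does not depend on $R$.\<close>

definition side_box :: "'a::euclidean_space \<Rightarrow> real \<Rightarrow> real \<Rightarrow> (('a \<times> real) \<times> real) set" where
  "side_box u b R = (ball ((2 * R) *\<^sub>R u) R \<times> {b/4<..<3*b/4}) \<times> {-R<..<R}"

lemma open_side_box: "open (side_box u b R)"
  unfolding side_box_def by (intro open_Times) auto

text \<open>The first component alone lies strictly between R and 3R, which separates boxes whose
  scales differ by a factor above 3.\<close>

lemma norm_fst_fst_side_box:
  assumes v: "v \<in> side_box u b R" and u: "norm u = 1"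
  shows "R < norm (fst (fst v))" "norm (fst (fst v)) < 3 * R"
proof -
  obtain v' vn vz where vv: "v = ((v', vn), vz)" by (metis prod.collapse)
  have 1: "norm ((2 * R) *\<^sub>R u - v') < R"
    using v by (auto simp: side_box_def vv dist_norm)
  then have "0 < R" using norm_ge_zero[of "(2 * R) *\<^sub>R u - v'"] by linarith
  then have "norm ((2 * R) *\<^sub>R u) = 2 * R" using u by simp
  moreover have "norm ((2 * R) *\<^sub>R u) \<le> norm ((2 * R) *\<^sub>R u - v') + norm v'"
    using norm_triangle_ineq[of "(2 * R) *\<^sub>R u - v'" v'] by simp
  moreover have "norm v' \<le> norm ((2 * R) *\<^sub>R u) + norm ((2 * R) *\<^sub>R u - v')"
    using norm_triangle_ineq4[of "(2 * R) *\<^sub>R u" "(2 * R) *\<^sub>R u - v'"] by simp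
  ultimately have "R < norm v'" "norm v' < 3 * R" using 1 by linarith+
  then show "R < norm (fst (fst v))" "norm (fst (fst v)) < 3 * R" by (simp_all add: vv)
qed

lemma norm_side_box:
  assumes v: "v \<in> side_box u b R" and u: "norm u = 1" and b: "b \<le> R"
  shows "R < norm v" "norm v < 5 * R"
proof -
  obtain v' vn vz where vv: "v = ((v', vn), vz)" by (metis prod.collapse)
  have 1: "b/4 < vn" "vn < 3*b/4" "\<bar>vz\<bar> < R"
    using v by (auto simp: side_box_def vv)
  have v': "R < norm v'" "norm v' < 3 * R"
    using norm_fst_fst_side_box[OF v u] by (simp_all add: vv)
  have "norm v' \<le> norm v"
    unfolding vv using norm_fst_le[of v' vn] norm_fst_le[of "(v', vn)" vz] by linarith
  moreover have "norm v \<le> norm v' + \<bar>vn\<bar> + \<bar>vz\<bar>"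
    unfolding vv using norm_Pair_le[of "(v', vn)" vz] norm_Pair_le[of v' vn] by simp
  ultimately show "R < norm v" "norm v < 5 * R" using v' 1 b by auto
qed

text \<open>Every point of the box has norm between R and 5R: the upper bound controls the kernel
  from below, and the lower one keeps the box clear of the cutoff.\<close>

lemma kern_cut_mass_box:
  fixes s R b e :: real and u :: "'a::euclidean_space"
  assumes s: "0 < s" and R: "0 < R" and b: "0 < b" "b \<le> R" and e: "e \<le> R" and u: "norm u = 1"
  shows "ennreal ((5 * R) powr (- (real DIM(('a \<times> real) \<times> real) + s)) * (unit_ball_vol (real DIM('a)) * R ^ DIM('a) * (b/2) * (2 * R)))
    \<le> (\<integral>\<^sup>+v. indicator (side_box u b R) v * kern_cut s e v \<partial>lborel)"
proof -
  let ?p = "(5 * R) powr (- (real DIM(('a \<times> real) \<times> real) + s))"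
  define X where "X = side_box u b R"
  have nrm: "R < norm v \<and> norm v \<le> 5 * R" if "v \<in> X" for v
    using norm_side_box[OF that[unfolded X_def] u b(2)] by simp
  have [measurable]: "X \<in> sets borel"
    unfolding X_def by (rule borel_open[OF open_side_box])
  have "emeasure lborel X = ennreal (unit_ball_vol (real DIM('a)) * R ^ DIM('a)) * ennreal (b/2) * ennreal (2 * R)"
  proof -
    have "emeasure lborel X = emeasure lborel (ball ((2 * R) *\<^sub>R u) R \<times> {b/4<..<3*b/4}) * emeasure lborel {-R<..<R}"
      unfolding X_def side_box_def lborel_prod[symmetric, where 'a="'a \<times> real" and 'b=real]
      by (rule lborel.emeasure_pair_measure_Times) (auto intro!: borel_Times)
    also have "emeasure lborel (ball ((2 * R) *\<^sub>R u) R \<times> {b/4<..<3*b/4}) = emeasure lborel (ball ((2 * R) *\<^sub>R u) R) * emeasure lborel {b/4<..<3*b/4}"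
      unfolding lborel_prod[symmetric, where 'a="'a" and 'b=real]
      by (rule lborel.emeasure_pair_measure_Times) auto
    finally show ?thesis using R b by (simp add: emeasure_ball)
  qed
  also have "\<dots> = ennreal (unit_ball_vol (real DIM('a)) * R ^ DIM('a) * (b/2) * (2 * R))"
    using R b by (simp only: ennreal_mult[symmetric] unit_ball_vol_nonneg of_nat_0_le_iff
        mult_nonneg_nonneg zero_le_power less_imp_le half_gt_zero_iff zero_le_numeral)
  finally have "ennreal (?p * (unit_ball_vol (real DIM('a)) * R ^ DIM('a) * (b/2) * (2 * R))) = ennreal ?p * emeasure lborel X"
    using R b by (simp only: ennreal_mult powr_ge_zero unit_ball_vol_nonneg of_nat_0_le_iff
        mult_nonneg_nonneg zero_le_power less_imp_le half_gt_zero_iff zero_le_numeral)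
  also have "\<dots> = (\<integral>\<^sup>+v. ennreal ?p * indicator X v \<partial>lborel)"
    by (simp add: nn_integral_cmult_indicator)
  also have "\<dots> \<le> (\<integral>\<^sup>+v. indicator X v * kern_cut s e v \<partial>lborel)"
  proof (rule nn_integral_mono)
    fix v
    show "ennreal ?p * indicator X v \<le> indicator X v * kern_cut s e v"
    proof (cases "v \<in> X")
      case True
      have "ennreal ?p \<le> kern s v"
        unfolding kern_def using nrm[OF True] s R by (intro ennreal_leI powr_mono2') auto
      then show ?thesis using True nrm[OF True] e by (simp add: kern_cut_def)
    qed simp
  qed
  finally show ?thesis by (simp only: X_def)
qed

section \<open>Stacking boxes over many scales\<close>

text \<open>With n = \<open>DIM('a)\<close>, the volume R^n * R^(1+s) * R exactly balances the
  kernel R^(-(n+2+s)), so each box carries at least the fixed mass \<open>m\<close>, and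
  \<open>N\<close> boxes with \<open>N * m\<close> \<ge> \<open>B\<close> suffice. The witness for
  \<open>\<rho>0\<close> is \<open>R N\<close>, smaller than every scale used, so no cutoff below it
  touches a box.\<close>

lemma kern_cut_mass_boxes:
  fixes s r \<kappa> B :: real and u :: "'a::euclidean_space"
  assumes s: "0 < s" and r: "0 < r" "r \<le> 1" and \<kappa>: "0 < \<kappa>" "\<kappa> \<le> 1" and u: "norm u = 1"
  shows "\<exists>\<rho>0>0. \<rho>0 \<le> r \<and> (\<exists>S\<in>sets borel.
    (\<forall>v\<in>S. norm v < r \<and> (\<exists>R. \<rho>0 \<le> R \<and> R \<le> 1 \<and> v \<in> side_box u (\<kappa> * R powr (1 + s)) R)) \<and>
    (\<forall>e\<le>\<rho>0. ennreal B \<le> (\<integral>\<^sup>+v. indicator S v * kern_cut s e v \<partial>lborel)))"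
proof -
  define n where "n = DIM('a)"
  have dim: "DIM(('a \<times> real) \<times> real) = n + 2" by (simp add: n_def)
  define p where "p = real (n + 2) + s"
  \<comment> \<open>The ratio 8 exceeds 3, which makes the boxes disjoint, and starting at r/6 keeps
    their outer radius 5R below r.\<close>
  define R where "R k = (1/8) ^ k * (r/6)" for k :: nat
  define b where "b k = \<kappa> * R k powr (1 + s)" for k
  define Y where "Y k = side_box u (b k) (R k)" for k
  define m where "m = 5 powr (- p) * unit_ball_vol n * \<kappa>"
  have R0: "0 < R k" for k using r by (simp add: R_def)
  have R_le: "R k \<le> r / 6" for k
    using r by (simp add: R_def power_le_one mult_left_le_one_le)
  have R1: "R k \<le> 1" for k using R_le[of k] r by linarith
  have R_anti: "8 * R j \<le> R i" if "i < j" for i j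
  proof -
    have "(1/8::real) ^ j \<le> (1/8) ^ Suc i" using that by (intro power_decreasing) auto
    then show ?thesis using r by (simp add: R_def)
  qed
  have b: "0 < b k" "b k \<le> R k" for k
  proof -
    show "0 < b k" using R0[of k] \<kappa> by (simp add: b_def)
    have "R k powr (1 + s) \<le> R k powr 1" using R0[of k] R1[of k] s by (intro powr_mono') auto
    then have "\<kappa> * R k powr (1 + s) \<le> 1 * R k" using R0[of k] \<kappa> by (intro mult_mono) auto
    then show "b k \<le> R k" by (simp add: b_def)
  qed
  have m0: "0 < m" using \<kappa> by (simp add: m_def)
  have mass: "ennreal m \<le> (\<integral>\<^sup>+v. indicator (Y k) v * kern_cut s e v \<partial>lborel)" if "e \<le> R k" for e k
  proof -
    have "R k powr (- p) * (R k ^ n * R k powr (1 + s) * R k) = R k powr (- p + (real n + (1 + s) + 1))"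
      using R0[of k] by (simp only: powr_add powr_realpow powr_one less_imp_le)
    also have "\<dots> = 1" using R0[of k] by (simp add: p_def)
    finally have 1: "R k powr (- p) * (R k ^ n * R k powr (1 + s) * R k) = 1" .
    have "(5 * R k) powr (- p) * (unit_ball_vol n * R k ^ n * (b k/2) * (2 * R k))
      = m * (R k powr (- p) * (R k ^ n * R k powr (1 + s) * R k))"
      using R0[of k] by (simp add: powr_mult b_def m_def)
    also have "\<dots> = m" by (simp only: 1 mult_1_right)
    finally have "(5 * R k) powr (- p) * (unit_ball_vol n * R k ^ n * (b k/2) * (2 * R k)) = m" .
    then show ?thesis
      using kern_cut_mass_box[OF s R0[of k] b[of k] that u] by (simp only: Y_def p_def dim n_def)
  qed
  obtain N :: nat where N: "B \<le> real N * m"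
    using ex_less_of_nat_mult[OF m0, of B] by (meson less_imp_le)
  define S where "S = (\<Union>k\<in>{..<N}. Y k)"
  have Y_sets [measurable]: "Y k \<in> sets borel" for k
    unfolding Y_def by (rule borel_open[OF open_side_box])
  have disj: "disjoint_family_on Y {..<N}"
  proof -
    have False if "i < j" "v \<in> Y i" "v \<in> Y j" for i j v
      using norm_fst_fst_side_box(1)[OF that(2)[unfolded Y_def] u] norm_fst_fst_side_box(2)[OF that(3)[unfolded Y_def] u]
        R_anti[OF that(1)] R0[of j] by linarith
    then show ?thesis unfolding disjoint_family_on_def by (metis disjoint_iff nat_neq_iff)
  qed
  have "ennreal B \<le> (\<integral>\<^sup>+v. indicator S v * kern_cut s e v \<partial>lborel)" if e: "e \<le> R N" for e
  proof -
    have "ennreal B \<le> (\<Sum>k<N. ennreal m)"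
      using N m0 by (simp add: ennreal_of_nat_eq_real_of_nat ennreal_mult[symmetric] ennreal_leI)
    also have "\<dots> \<le> (\<Sum>k<N. \<integral>\<^sup>+v. indicator (Y k) v * kern_cut s e v \<partial>lborel)"
    proof (intro sum_mono mass)
      fix k assume "k \<in> {..<N}"
      then show "e \<le> R k" using R_anti[of k N] R0[of N] e by auto
    qed
    also have "\<dots> = (\<integral>\<^sup>+v. (\<Sum>k<N. indicator (Y k) v * kern_cut s e v) \<partial>lborel)"
      using Y_sets kern_cut_measurable
      by (intro nn_integral_sum[symmetric] borel_measurable_times borel_measurable_indicator) simp_all
    also have "\<dots> = (\<integral>\<^sup>+v. indicator S v * kern_cut s e v \<partial>lborel)"
      unfolding S_def using disj by (simp add: indicator_UN_disjoint sum_distrib_right)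
    finally show ?thesis .
  qed
  moreover have "S \<in> sets borel" unfolding S_def by measurable
  moreover have "norm v < r \<and> (\<exists>R'. R N \<le> R' \<and> R' \<le> 1 \<and> v \<in> side_box u (\<kappa> * R' powr (1 + s)) R')" if "v \<in> S" for v
  proof -
    obtain k where k: "k < N" "v \<in> side_box u (b k) (R k)" using \<open>v \<in> S\<close> by (auto simp: S_def Y_def)
    have "norm v < r" using norm_side_box(2)[OF k(2) u b(2)] R_le[of k] r by linarith
    moreover have "R N \<le> R k" using R_anti[OF k(1)] R0[of N] by linarith
    ultimately show ?thesis using k(2) R1[of k] by (auto simp: b_def)
  qed
  moreover have "R N \<le> r" using R_le[of N] r by linarith
  ultimately show ?thesis using R0[of N] by blast
qed

section \<open>Parabolic caps of a minimal set are null\<close>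

text \<open>Calibration bounds \<open>Ls s A (- E)\<close> from below by
  \<open>Ls s A (E - A)\<close> plus the measure of \<open>A\<close>, while \<open>min\<close>
  bounds it from above by \<open>Ls s A (E - A)\<close>. These energies are finite, so the measure
  vanishes.\<close>

lemma parabolic_cap_null:
  fixes s c r \<rho> \<epsilon> :: real and \<phi> :: "'a::euclidean_space \<Rightarrow> real" and E \<Omega> :: "(('a \<times> real) \<times> real) set"
  assumes s: "0 < s" "s < 1" and c: "0 < c" and \<epsilon>: "0 < \<epsilon>" and \<rho>: "0 < \<rho>" "\<rho> \<le> 1"
    and E: "E \<in> sets lebesgue" and \<Omega>: "\<Omega> \<in> sets lebesgue"
    and \<phi>: "\<And>x'. norm x' < \<rho> \<Longrightarrow> c * norm x' powr (1 + s) \<le> \<phi> x'"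
    and \<Omega>_graph: "\<And>y. fst y \<in> ball 0 \<rho> \<Longrightarrow> y \<in> \<Omega> \<longleftrightarrow> \<phi> (fst (fst y)) < snd (fst y)"
    and E_sub: "\<And>y. y \<in> E \<Longrightarrow> fst y \<in> ball 0 \<rho> \<Longrightarrow> 0 < snd y \<Longrightarrow> y \<in> \<Omega>"
    and min: "\<And>A. A \<in> sets lebesgue \<Longrightarrow> A \<subseteq> E \<inter> \<Omega> \<Longrightarrow> bounded A \<Longrightarrow> Ls s A (- E) \<le> Ls s A (E - A) \<and> Ls s A (- E) < \<infinity>"
  shows "\<exists>\<delta>>0. \<exists>M. \<forall>h\<ge>\<epsilon>. emeasure lebesgue
    {y \<in> E \<inter> \<Omega>. fst y \<in> ball 0 \<rho> \<and> snd (fst y) + M * (snd y - h)\<^sup>2 < \<delta>} = 0"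
proof -
  obtain u :: 'a where u: "norm u = 1"
    using nonempty_Basis norm_Basis by blast
  \<comment> \<open>Within distance \<open>r\<close> of the cap, points stay above height 0 and over
    the ball of radius \<rho>, so \<open>E_sub\<close> and \<open>\<Omega>_graph\<close> apply; the
    factor 4 leaves room for the size of the cap itself.\<close>
  define r where "r = min \<rho> \<epsilon> / 4"
  have r: "0 < r" "r \<le> 1" "4 * r \<le> \<rho>" "4 * r \<le> \<epsilon>"
    using \<epsilon> \<rho> by (auto simp: r_def)
  \<comment> \<open>The minimum with 1 gives b \<le> R. The power of 1/2 pays for recentring at a
    cap point: with |x'| < R/2 and |v'| > R the wall is only known to be at least c (R/2)^(1+s) high
    at x' + v'.\<close>
  define \<kappa> where "\<kappa> = min 1 (c * (1/2) powr (1 + s))"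
  have \<kappa>: "0 < \<kappa>" "\<kappa> \<le> 1" using c by (auto simp: \<kappa>_def)
  obtain BW where BW: "0 \<le> BW" "(\<integral>\<^sup>+v. indicator {v::('a \<times> real) \<times> real. r \<le> norm v} v * kern s v \<partial>lborel) \<le> ennreal BW"
    using kern_mass_tail[OF s(1) r(1)] by (elim exE conjE) (rule that, assumption+)
  obtain BT where BT0: "0 \<le> BT" and BT1: "\<forall>m M. 0 \<le> M \<longrightarrow> M \<le> 1 \<longrightarrow>
      (\<integral>\<^sup>+v. indicator {v :: ('a \<times> real) \<times> real. norm v < r
        \<and> - M * (snd v)\<^sup>2 \<le> snd (fst v) + m * snd v \<and> snd (fst v) + m * snd v \<le> 0} v * kern s v \<partial>lborel) \<le> ennreal BT"
    using kern_mass_parabolic_layer[OF s r(1), where 'a='a] by (elim exE conjE) (rule that, assumption+)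
  note BT = BT0 BT1[rule_format]
  obtain \<rho>0 S where \<rho>0: "0 < \<rho>0" "\<rho>0 \<le> r" and S_sets: "S \<in> sets borel" and
      S_box: "\<forall>v\<in>S. norm v < r \<and> (\<exists>R. \<rho>0 \<le> R \<and> R \<le> 1 \<and> v \<in> side_box u (\<kappa> * R powr (1 + s)) R)" and
      S_mass: "\<forall>e\<le>\<rho>0. ennreal (BT + BT + BW + 1) \<le> (\<integral>\<^sup>+v. indicator S v * kern_cut s e v \<partial>lborel)"
    using kern_cut_mass_boxes[OF s(1) r(1,2) \<kappa> u, of "BT + BT + BW + 1"]
    by (elim exE conjE bexE) (rule that, assumption+)
  have S: "S \<in> sets borel" "\<And>v. v \<in> S \<Longrightarrow> norm v < r"
      "\<And>v. v \<in> S \<Longrightarrow> \<exists>R. \<rho>0 \<le> R \<and> R \<le> 1 \<and> v \<in> side_box u (\<kappa> * R powr (1 + s)) R"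
      "\<And>e. e \<le> \<rho>0 \<Longrightarrow> ennreal (BT + BT + BW + 1) \<le> (\<integral>\<^sup>+v. indicator S v * kern_cut s e v \<partial>lborel)"
    using S_sets S_box S_mass by auto
  \<comment> \<open>In this order: \<open>M\<close> \<le> 1; the tilt of the tangent changes a box
    by at most b/4; the height of x adds at most b/4; cap points satisfy |x'| <
    \<open>\<rho>0 / 2\<close>; the cap stays inside the near field.\<close>
  define \<delta> where "\<delta> = Min {r\<^sup>2, r * \<kappa> * \<rho>0 powr s / 8, \<kappa> * \<rho>0 powr (1 + s) / 4, c * (\<rho>0 / 2) powr (1 + s), r}"
  have \<delta>: "0 < \<delta>" "\<delta> \<le> r\<^sup>2" "\<delta> \<le> r * \<kappa> * \<rho>0 powr s / 8" "\<delta> \<le> \<kappa> * \<rho>0 powr (1 + s) / 4"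
      "\<delta> \<le> c * (\<rho>0 / 2) powr (1 + s)" "\<delta> \<le> r"
    using r \<kappa> \<rho>0 c by (auto simp: \<delta>_def)
  \<comment> \<open>Chosen so that x_n > 0 and \<open>q x < 0\<close> force \<open>snd x\<close> to
    lie within \<open>r\<close> of \<open>h\<close>.\<close>
  define M where "M = \<delta> / r\<^sup>2"
  have M: "0 < M" "M \<le> 1" using \<delta> r by (auto simp: M_def)
  have "emeasure lebesgue {y \<in> E \<inter> \<Omega>. fst y \<in> ball 0 \<rho> \<and> snd (fst y) + M * (snd y - h)\<^sup>2 < \<delta>} = 0"
    if h: "\<epsilon> \<le> h" for h
  proof -
    define q where "q y = snd (fst y) + M * (snd y - h)\<^sup>2 - \<delta>" for y :: "('a \<times> real) \<times> real"
    define A where "A = {y \<in> E \<inter> \<Omega>. fst y \<in> ball 0 \<rho> \<and> q y < 0}"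
    have q_cont: "continuous_on UNIV q"
      unfolding q_def by (intro continuous_intros)
    then have q: "q \<in> borel_measurable borel"
      by (rule borel_measurable_continuous_onI)
    have "open {y :: ('a \<times> real) \<times> real. fst y \<in> ball 0 \<rho> \<and> q y < 0}"
    proof -
      have "open (fst -` ball (0 :: 'a \<times> real) \<rho> :: (('a \<times> real) \<times> real) set)"
        by (intro open_vimage_fst open_ball)
      moreover have "open {y. q y < 0}"
        using q_cont by (intro open_Collect_less) auto
      ultimately have "open (fst -` ball (0 :: 'a \<times> real) \<rho> \<inter> {y :: ('a \<times> real) \<times> real. q y < 0})"
        by (rule open_Int)
      then show ?thesis by (simp add: vimage_def Collect_conj_eq)
    qed
    then have "{y :: ('a \<times> real) \<times> real. fst y \<in> ball 0 \<rho> \<and> q y < 0} \<in> sets lebesgue"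
      by (intro sets_completionI_sets) simp
    then have "(E \<inter> \<Omega>) \<inter> {y. fst y \<in> ball 0 \<rho> \<and> q y < 0} \<in> sets lebesgue"
      using E \<Omega> by (intro sets.Int)
    moreover have "A = (E \<inter> \<Omega>) \<inter> {y. fst y \<in> ball 0 \<rho> \<and> q y < 0}"
      by (auto simp: A_def)
    ultimately have A: "A \<in> sets lebesgue" by simp
    have A_pos: "\<bar>snd x - h\<bar> < r \<and> 0 < snd (fst x) \<and> snd (fst x) < \<delta> \<and> norm (fst (fst x)) < \<rho>0 / 2" if x: "x \<in> A" for x
    proof -
      have nx: "norm (fst (fst x)) < \<rho>"
        using x norm_fst_le[of "fst (fst x)" "snd (fst x)"] by (auto simp: A_def)
      have "fst x \<in> ball 0 \<rho>" "x \<in> \<Omega>" using x by (simp_all add: A_def)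
      then have xn: "\<phi> (fst (fst x)) < snd (fst x)" using \<Omega>_graph by blast
      have low: "c * norm (fst (fst x)) powr (1 + s) < snd (fst x)" using \<phi>[OF nx] xn by linarith
      have "0 \<le> c * norm (fst (fst x)) powr (1 + s)" using c by simp
      then have pos: "0 < snd (fst x)" using low by linarith
      have qx: "q x < 0" using x by (simp add: A_def)
      have "0 \<le> M * (snd x - h)\<^sup>2" using M by simp
      then have lt: "snd (fst x) < \<delta>" using qx unfolding q_def by linarith
      have "M * (snd x - h)\<^sup>2 < \<delta>" using qx pos unfolding q_def by linarith
      then have "(snd x - h)\<^sup>2 < r\<^sup>2" using \<delta>(1) r(1) by (simp add: M_def field_simps)
      then have "\<bar>snd x - h\<bar> < r" using r(1) by (metis abs_square_less_1 abs_le_square_iff abs_of_pos not_le)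
      moreover have "norm (fst (fst x)) < \<rho>0 / 2"
      proof (rule ccontr)
        assume "\<not> ?thesis"
        then have "(\<rho>0 / 2) powr (1 + s) \<le> norm (fst (fst x)) powr (1 + s)"
          using \<rho>0 s by (intro powr_mono2) auto
        then have "c * (\<rho>0 / 2) powr (1 + s) \<le> c * norm (fst (fst x)) powr (1 + s)"
          using c by (intro mult_left_mono) auto
        then show False using low lt \<delta>(5) by linarith
      qed
      ultimately show ?thesis using pos lt by blast
    qed
    have near: "fst y \<in> ball 0 \<rho> \<and> 0 < snd y" if x: "x \<in> A" and y: "norm (y - x) < r" for x y
    proof -
      have "\<bar>snd y - snd x\<bar> < r" using norm_snd_le[of "snd (y - x)" "fst (y - x)", unfolded prod.collapse] y by simp
      moreover have "norm (fst y - fst x) < r" using norm_fst_le[of "fst (y - x)" "snd (y - x)", unfolded prod.collapse] y by simp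
      moreover have "norm (fst x) \<le> norm (fst (fst x)) + \<bar>snd (fst x)\<bar>"
        using norm_Pair_le[of "fst (fst x)" "snd (fst x)"] by simp
      moreover have "norm (fst y) \<le> norm (fst x) + norm (fst y - fst x)"
        using norm_triangle_ineq[of "fst x" "fst y - fst x"] by simp
      ultimately show ?thesis
        using A_pos[OF x] r \<rho>0 \<delta>(6) h by auto
    qed
    have A_bdd: "bounded A"
    proof (rule boundedI)
      fix x assume x: "x \<in> A"
      have "norm x \<le> norm (fst x) + \<bar>snd x\<bar>"
        using norm_Pair_le[of "fst x" "snd x"] by simp
      moreover have "norm (fst x) < \<rho>" using x by (simp add: A_def)
      ultimately show "norm x \<le> \<rho> + (\<bar>h\<bar> + r)" using A_pos[OF x] by linarith
    qed
    have A_fin: "emeasure lebesgue A < \<infinity>"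
      using bounded_set_imp_lmeasurable[OF A_bdd A] by (simp add: fmeasurable_def del: emeasure_completion)
    have "Ls s A (E - A) + emeasure lebesgue A \<le> Ls s A (- E)"
    proof (rule calibration[where \<eta> = \<rho>0, OF s(1) q A _ _ A_fin])
      show "E - A \<in> sets lebesgue" using E A by simp
      show Ec: "- E \<in> sets lebesgue" using sets.compl_sets[OF E] by (simp add: Compl_eq_Diff_UNIV)
      show "A \<inter> (E - A) = {}" "A \<inter> - E = {}" by (auto simp: A_def)
      show "0 < \<rho>0" by fact
      fix x e assume x: "x \<in> A" and e: "0 < e" "e \<le> \<rho>0"
      \<comment> \<open>\<open>m\<close> is the vertical derivative of \<open>q\<close> at
        \<open>x\<close> and \<open>l\<close> its linear part. As \<open>q\<close> is quadratic,
        \<open>q_shift\<close> is an exact Taylor expansion, whose remainder is the thickness of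
        \<open>T\<close>.\<close>
      define m where "m = 2 * M * (snd x - h)"
      define l where "l v = snd (fst v) + m * snd v" for v :: "('a \<times> real) \<times> real"
      have q_shift: "q y - q x = l (y - x) + M * (snd (y - x))\<^sup>2" for y
        by (simp add: q_def l_def m_def algebra_simps power2_eq_square)
      have q_lebesgue: "q \<in> borel_measurable lebesgue"
        using q by (intro measurable_completion) simp
      have l_cont: "continuous_on UNIV l"
        unfolding l_def by (intro continuous_intros)
      then have l_meas [measurable]: "l \<in> borel_measurable borel"
        by (rule borel_measurable_continuous_onI)
      have E_near: "y \<in> \<Omega>" if "y \<in> E" "norm (y - x) < r" for y
        using E_sub[OF that(1)] near[OF x that(2)] by blast
      \<comment> \<open>The box occupies heights b/4 to 3b/4: the lower margin absorbs the tilt, the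
        upper one the shift by x. Its points are thus inside the tangent half-space and yet below
        the wall.\<close>
      have S_l: "0 < l v \<and> x + v \<notin> \<Omega>" if v: "v \<in> S" for v
      proof -
        obtain R where R: "\<rho>0 \<le> R" "R \<le> 1" and vR: "v \<in> side_box u (\<kappa> * R powr (1 + s)) R"
          using S(3)[OF v] by blast
        define b where "b = \<kappa> * R powr (1 + s)"
        have v1: "b / 4 < snd (fst v)" "snd (fst v) < 3 * b / 4" "\<bar>snd v\<bar> < R"
          using vR by (auto simp: side_box_def b_def[symmetric])
        have v2: "R < norm (fst (fst v))" using norm_fst_fst_side_box(1)[OF vR u] .
        have R0: "0 < R" using R \<rho>0 by linarith
        have bR: "b = \<kappa> * R powr s * R" using R0 by (simp add: b_def powr_add)
        have Rs: "\<rho>0 powr s \<le> R powr s" "\<rho>0 powr (1 + s) \<le> R powr (1 + s)"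
          using R \<rho>0 s by (auto intro: powr_mono2)
        have "\<bar>m\<bar> = 2 * M * \<bar>snd x - h\<bar>" using M by (simp add: m_def abs_mult)
        also have "\<dots> \<le> 2 * M * r" using A_pos[OF x] M by (intro mult_left_mono) auto
        also have "\<dots> = 2 * \<delta> / r" using r by (simp add: M_def power2_eq_square)
        also have "\<dots> \<le> \<kappa> * \<rho>0 powr s / 4" using \<delta>(3) r by (simp add: field_simps)
        also have "\<dots> \<le> \<kappa> * R powr s / 4" using Rs(1) \<kappa> by simp
        finally have m_le: "\<bar>m\<bar> \<le> \<kappa> * R powr s / 4" .
        have "\<bar>m * snd v\<bar> \<le> \<kappa> * R powr s / 4 * R"
          unfolding abs_mult using m_le v1(3) by (intro mult_mono) auto
        also have "\<dots> = b / 4" by (simp add: bR)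
        finally have "\<bar>m * snd v\<bar> \<le> b / 4" .
        then have l_pos: "0 < l v" using v1(1) by (auto simp: l_def)
        have "\<kappa> * \<rho>0 powr (1 + s) \<le> b" unfolding b_def using Rs(2) \<kappa> by simp
        then have "4 * \<delta> \<le> b" using \<delta>(4) by linarith
        then have le_b: "snd (fst (x + v)) < b" using v1(2) A_pos[OF x] by simp
        have nv: "norm (x + v - x) < r" using S(2)[OF v] by simp
        have loc: "fst (x + v) \<in> ball 0 \<rho>" using near[OF x nv] by blast
        then have nxv: "norm (fst (fst (x + v))) < \<rho>"
          using norm_fst_le[of "fst (fst (x + v))" "snd (fst (x + v))", unfolded prod.collapse] by simp
        have "norm (fst (fst v)) \<le> norm (fst (fst (x + v))) + norm (fst (fst x))"
          using norm_triangle_ineq4[of "fst (fst (x + v))" "fst (fst x)"] by simp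
        then have "R / 2 \<le> norm (fst (fst (x + v)))" using v2 A_pos[OF x] R(1) by linarith
        then have "(R / 2) powr (1 + s) \<le> norm (fst (fst (x + v))) powr (1 + s)"
          using R0 s by (intro powr_mono2) auto
        then have "c * (R / 2) powr (1 + s) \<le> \<phi> (fst (fst (x + v)))"
          using \<phi>[OF nxv] c by (meson mult_left_mono less_imp_le order_trans)
        moreover have "b \<le> c * (R / 2) powr (1 + s)"
        proof -
          have "b \<le> (c * (1/2) powr (1 + s)) * R powr (1 + s)"
            unfolding b_def \<kappa>_def by (intro mult_right_mono) auto
          also have "\<dots> = c * (R / 2) powr (1 + s)"
            using R0 by (simp add: powr_divide)
          finally show ?thesis .
        qed
        ultimately have "\<not> \<phi> (fst (fst (x + v))) < snd (fst (x + v))" using le_b by linarith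
        then show ?thesis using l_pos \<Omega>_graph[OF loc] by blast
      qed
      \<comment> \<open>\<open>H\<close> and \<open>T\<close> stop at radius \<open>r\<close>;
        beyond it nothing is known about \<open>E\<close>, and all of it is charged to
        \<open>W\<close>.\<close>
      define H where "H = {v :: ('a \<times> real) \<times> real. norm v < r \<and> 0 < l v}"
      define T where "T = {v :: ('a \<times> real) \<times> real. norm v < r \<and> - M * (snd v)\<^sup>2 \<le> l v \<and> l v \<le> 0}"
      define W where "W = {v :: ('a \<times> real) \<times> real. r \<le> norm v}"
      show "(\<integral>\<^sup>+y. indicator (E - A \<union> {y \<in> A. q x \<le> q y}) y * kern_cut s e (x - y) \<partial>lebesgue) + 1
        \<le> (\<integral>\<^sup>+y. indicator (- E \<union> {y \<in> A. q y < q x}) y * kern_cut s e (x - y) \<partial>lebesgue)"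
      proof (rule kern_cut_mass_excess[where H = H and T = T and S = S and W = W and BT = BT and BW = BW])
        show "H \<in> sets borel" "T \<in> sets borel" "W \<in> sets borel" unfolding H_def T_def W_def by measurable
        show "S \<in> sets borel" by (rule S(1))
        have "{y \<in> A. q x \<le> q y} = A \<inter> (q -` {q x..} \<inter> space lebesgue)" "{y \<in> A. q y < q x} = A \<inter> (q -` {..<q x} \<inter> space lebesgue)"
          by auto
        then have "{y \<in> A. q x \<le> q y} \<in> sets lebesgue" "{y \<in> A. q y < q x} \<in> sets lebesgue"
          using A measurable_sets[OF q_lebesgue, of "{q x..}"] measurable_sets[OF q_lebesgue, of "{..<q x}"]
          by (simp_all only: sets.Int atLeast_borel lessThan_borel)
        then show "E - A \<union> {y \<in> A. q x \<le> q y} \<in> sets lebesgue" "- E \<union> {y \<in> A. q y < q x} \<in> sets lebesgue"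
          using E Ec A by auto
        show "S \<subseteq> H" using S_l S(2) by (auto simp: H_def)
        show "- v \<notin> H" if "v \<in> S" for v using S_l[OF that] by (simp add: H_def l_def)
        show "y - x \<in> H - S \<union> T \<union> W" if y: "y \<in> E - A \<union> {y \<in> A. q x \<le> q y}" for y
        proof (cases "norm (y - x) < r")
          case True
          have yE: "y \<in> E" using y by (auto simp: A_def)
          have y\<Omega>: "y \<in> \<Omega>" by (rule E_near[OF yE True])
          \<comment> \<open>A point of \<open>E\<close> near \<open>x\<close> lies in \<Omega>, so
            if it is not in \<open>A\<close> then \<open>q y\<close> \<ge> 0 >
            \<open>q x\<close>.\<close>
          have "q x \<le> q y"
            using y y\<Omega> near[OF x True] x by (fastforce simp: A_def)
          then have "- M * (snd (y - x))\<^sup>2 \<le> l (y - x)" using q_shift[of y] by linarith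
          moreover have "y - x \<notin> S" using S_l[of "y - x"] y\<Omega> by auto
          ultimately show ?thesis using True by (auto simp: H_def T_def not_less)
        qed (simp add: W_def)
        show "y \<in> - E \<union> {y \<in> A. q y < q x}" if "y - x \<in> S" for y
          using S_l[OF that] E_near[of y] S(2)[OF that] by auto
        show "y \<in> - E \<union> {y \<in> A. q y < q x}" if y: "x - y \<in> H" "y - x \<notin> T" for y
        proof (cases "y \<in> E")
          case True
          have nr: "norm (y - x) < r" using y(1) by (simp add: H_def norm_minus_commute)
          have "l (y - x) = - l (x - y)" by (simp add: l_def algebra_simps)
          then have "l (y - x) < 0" using y(1) by (simp add: H_def)
          \<comment> \<open>Being on the negative side but outside the layer means lying below the
            parabola through \<open>x\<close>; hence \<open>q y < q x < 0\<close>, which puts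
            \<open>y\<close> into \<open>A\<close>.\<close>
          then have "l (y - x) < - M * (snd (y - x))\<^sup>2" using y(2) nr by (auto simp: T_def)
          then have "q y < q x" using q_shift[of y] by linarith
          moreover have "q x < 0" using x by (simp add: A_def)
          ultimately show ?thesis using True E_near[OF True nr] near[OF x nr] by (auto simp: A_def)
        qed simp
        show "(\<integral>\<^sup>+v. indicator T v * kern s v \<partial>lborel) \<le> ennreal BT"
          unfolding T_def l_def using M by (intro BT(2)) auto
        show "(\<integral>\<^sup>+v. indicator W v * kern s v \<partial>lborel) \<le> ennreal BW"
          unfolding W_def by (rule BW(2))
        show "0 \<le> BT" "0 \<le> BW" by fact+
        show "ennreal (BT + BT + BW + 1) \<le> (\<integral>\<^sup>+v. indicator S v * kern_cut s e v \<partial>lborel)"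
          by (rule S(4)[OF e(2)])
      qed
    qed
    moreover have "Ls s A (- E) \<le> Ls s A (E - A)" "Ls s A (- E) < \<infinity>"
      using min[OF A _ A_bdd] by (auto simp: A_def)
    ultimately have "Ls s A (E - A) + emeasure lebesgue A \<le> Ls s A (E - A) + 0" "Ls s A (E - A) < \<infinity>"
      by (simp_all only: add_0_right) (meson order_trans le_less_trans le_iff_add add_increasing2 order_refl)+
    then have "emeasure lebesgue A \<le> 0"
      by (subst (asm) ennreal_add_left_cancel_le) (auto simp del: emeasure_completion)
    then show ?thesis by (simp add: A_def q_def del: emeasure_completion)
  qed
  then show ?thesis using \<delta>(1) by blast
qed

section \<open>From null caps to a pointwise height bound\<close>

text \<open>\<open>'a\<close> stands for the space of the variables x'. Minimality does not see null
  sets, so the energy argument alone gives an almost-everywhere statement;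
  \<open>normalized_in\<close> turns it into one about every point.\<close>

theorem theorem1p3:
  fixes s :: real and \<omega> :: "('a::euclidean_space \<times> real) set"
    and \<phi> :: "'a \<Rightarrow> real" and \<psi> :: "'a \<times> real \<Rightarrow> real"
    and E :: "(('a \<times> real) \<times> real) set"
    and \<rho> c \<beta> :: real
  assumes s: "0 < s" "s < 1"
    and \<omega>: "open \<omega>" "bounded \<omega>"
    and lip: "lipschitz_boundary (\<omega> \<times> (UNIV :: real set))"
    and \<rho>: "\<rho> > 0"
    and \<phi>_nonneg: "\<forall>x'. \<phi> x' \<ge> 0" and \<phi>0: "\<phi> 0 = 0"
    and c: "c > 0" and \<beta>: "0 < \<beta>" "\<beta> \<le> s + 1"
    and \<phi>_lower: "\<forall>x'. norm x' < \<rho> \<longrightarrow> \<phi> x' \<ge> c * norm x' powr \<beta>"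
    and \<omega>_graph: "\<omega> \<inter> ball 0 \<rho> = {(x', t). t > \<phi> x'} \<inter> ball 0 \<rho>"
    and \<psi>: "Linfty_loc \<psi>" and \<psi>_nonpos: "\<forall>x \<in> ball 0 \<rho>. \<psi> x \<le> 0"
    and E_min: "s_minimal s E (\<omega> \<times> UNIV)"
    and E_norm: "normalized_in E (\<omega> \<times> UNIV)"
    and E_ext: "E - (\<omega> \<times> UNIV) = {(x, z). z < \<psi> x} - (\<omega> \<times> UNIV)"
  shows "\<forall>\<epsilon>>0. \<exists>\<delta>>0. E \<inter> (ball 0 \<delta> \<times> UNIV) \<subseteq> {X. snd X \<le> \<epsilon>}"
proof (intro allI impI)
  fix \<epsilon> :: real assume \<epsilon>: "0 < \<epsilon>"
  define \<Omega> :: "(('a \<times> real) \<times> real) set" where "\<Omega> = \<omega> \<times> UNIV"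
  \<comment> \<open>For |x'| \<le> 1 a power with exponent \<beta> \<le> 1+s dominates the one with
    exponent 1+s, the only case treated above.\<close>
  define \<rho>1 where "\<rho>1 = min \<rho> 1"
  have \<rho>1: "0 < \<rho>1" "\<rho>1 \<le> 1" "\<rho>1 \<le> \<rho>" using \<rho> by (auto simp: \<rho>1_def)
  have \<Omega>_open: "open \<Omega>" unfolding \<Omega>_def using \<omega>(1) by (intro open_Times) auto
  then have \<Omega>_sets: "\<Omega> \<in> sets lebesgue" by (intro sets_completionI_sets) simp
  have E_sets: "E \<in> sets lebesgue" using E_min by (simp add: s_minimal_def)
  have \<phi>_ge: "c * norm x' powr (1 + s) \<le> \<phi> x'" if "norm x' < \<rho>1" for x'
  proof -
    have "norm x' powr (1 + s) \<le> norm x' powr \<beta>"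
      using that \<rho>1 \<beta> by (cases "x' = 0") (auto intro!: powr_mono')
    then have "c * norm x' powr (1 + s) \<le> c * norm x' powr \<beta>" using c by simp
    also have "\<dots> \<le> \<phi> x'" using \<phi>_lower that \<rho>1(3) by simp
    finally show ?thesis .
  qed
  have graph: "y \<in> \<Omega> \<longleftrightarrow> \<phi> (fst (fst y)) < snd (fst y)" if "fst y \<in> ball 0 \<rho>1" for y
  proof -
    have "fst y \<in> ball 0 \<rho>" using that \<rho>1 by auto
    moreover have "fst y \<in> \<omega> \<inter> ball 0 \<rho> \<longleftrightarrow> fst y \<in> {(x', t). t > \<phi> x'} \<inter> ball 0 \<rho>"
      by (simp only: \<omega>_graph)
    ultimately show ?thesis by (simp add: \<Omega>_def mem_Times_iff case_prod_unfold)
  qed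
  have E_sub: "y \<in> \<Omega>" if "y \<in> E" "fst y \<in> ball 0 \<rho>1" "0 < snd y" for y
  proof (rule ccontr)
    assume "y \<notin> \<Omega>"
    then have "y \<in> E - \<omega> \<times> UNIV" using that(1) by (simp add: \<Omega>_def)
    then have "y \<in> {(x, z). z < \<psi> x}" by (simp add: E_ext)
    moreover have "\<psi> (fst y) \<le> 0" using \<psi>_nonpos that(2) \<rho>1 by auto
    ultimately show False using that(3) by (simp add: case_prod_unfold)
  qed
  have delete: "Ls s A (- E) \<le> Ls s A (E - A) \<and> Ls s A (- E) < \<infinity>"
    if A: "A \<in> sets lebesgue" "A \<subseteq> E \<inter> \<Omega>" "bounded A" for A
  proof -
    \<comment> \<open>A bounded \<open>A\<close> fits into a bounded open part of \<Omega>, where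
      minimality can be invoked although \<Omega> itself is unbounded.\<close>
    obtain K where K: "A \<subseteq> ball 0 K" using bounded_subset_ballD[OF A(3)] by blast
    define U where "U = \<Omega> \<inter> ball 0 K"
    have U: "open U" "bounded U" "U \<subseteq> \<Omega>"
      using \<Omega>_open by (auto simp: U_def intro: bounded_Int)
    then have "s_minimal_bdd s E U" using E_min by (simp add: s_minimal_def \<Omega>_def)
    moreover have "U \<in> sets lebesgue" using U(1) by (intro sets_completionI_sets) simp
    moreover have "A \<subseteq> E \<inter> U" using A(2) K by (auto simp: U_def)
    ultimately show ?thesis using s_minimal_bdd_delete[OF _ _ A(1)] by simp
  qed
  have "\<exists>\<delta>>0. \<exists>M. \<forall>h\<ge>\<epsilon>. emeasure lebesgue
      {y \<in> E \<inter> \<Omega>. fst y \<in> ball 0 \<rho>1 \<and> snd (fst y) + M * (snd y - h)\<^sup>2 < \<delta>} = 0"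
    by (rule parabolic_cap_null[OF s c \<epsilon> \<rho>1(1,2) E_sets \<Omega>_sets]) (rule \<phi>_ge graph E_sub delete; assumption)+
  then obtain \<delta> M where \<delta>: "0 < \<delta>" and null: "\<forall>h\<ge>\<epsilon>. emeasure lebesgue
      {y \<in> E \<inter> \<Omega>. fst y \<in> ball 0 \<rho>1 \<and> snd (fst y) + M * (snd y - h)\<^sup>2 < \<delta>} = 0"
    by (elim exE conjE) (rule that, assumption+)
  have "E \<inter> (ball 0 (min \<delta> \<rho>1) \<times> UNIV) \<subseteq> {X. snd X \<le> \<epsilon>}"
  proof
    fix X assume X: "X \<in> E \<inter> (ball 0 (min \<delta> \<rho>1) \<times> UNIV)"
    show "X \<in> {X. snd X \<le> \<epsilon>}"
    proof (rule ccontr)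
      assume "X \<notin> {X. snd X \<le> \<epsilon>}"
      then have h: "\<epsilon> < snd X" by simp
      \<comment> \<open>The vertex of the parabola is put at the height of \<open>X\<close>. There
        the quadratic term vanishes, so |x_n| < \<delta> already places \<open>X\<close> in the open
        set \<open>G\<close>.\<close>
      define G where "G = {y. fst y \<in> ball (0 :: 'a \<times> real) \<rho>1 \<and> snd (fst y) + M * (snd y - snd X)\<^sup>2 < \<delta>}"
      have XE: "X \<in> E" and Xn: "norm (fst X) < \<delta>" "norm (fst X) < \<rho>1"
        using X by (auto simp: mem_Times_iff)
      have "X \<in> \<Omega>" using E_sub[OF XE] Xn(2) h \<epsilon> by simp
      have "\<bar>snd (fst X)\<bar> \<le> norm (fst X)"
        using norm_snd_le[of "snd (fst X)" "fst (fst X)"] by simp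
      then have "X \<in> G" using Xn by (simp add: G_def)
      have "open G"
      proof -
        have "open (fst -` ball (0 :: 'a \<times> real) \<rho>1 \<inter> {y :: ('a \<times> real) \<times> real. snd (fst y) + M * (snd y - snd X)\<^sup>2 < \<delta>})"
          by (intro open_Int open_vimage_fst open_ball open_Collect_less continuous_intros)
        then show ?thesis by (simp add: G_def vimage_def Collect_conj_eq)
      qed
      then have "open (\<Omega> \<inter> G)" using \<Omega>_open by (rule open_Int[rotated])
      then obtain t where t: "0 < t" "ball X t \<subseteq> \<Omega> \<inter> G"
        using \<open>X \<in> \<Omega>\<close> \<open>X \<in> G\<close> open_contains_ball by blast
      have "G \<in> sets lebesgue" using \<open>open G\<close> by (intro sets_completionI_sets) simp
      then have "E \<inter> \<Omega> \<inter> G \<in> sets lebesgue" using E_sets \<Omega>_sets by (intro sets.Int)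
      moreover have "emeasure lebesgue (E \<inter> \<Omega> \<inter> G) = 0"
      proof -
        have "E \<inter> \<Omega> \<inter> G = {y \<in> E \<inter> \<Omega>. fst y \<in> ball 0 \<rho>1 \<and> snd (fst y) + M * (snd y - snd X)\<^sup>2 < \<delta>}"
          by (auto simp: G_def)
        then show ?thesis using null[rule_format, of "snd X"] h by (simp del: emeasure_completion)
      qed
      moreover have "ball X t \<inter> E \<subseteq> E \<inter> \<Omega> \<inter> G" using t(2) by blast
      ultimately have "emeasure lebesgue (ball X t \<inter> E) = 0"
        using emeasure_eq_0 by blast
      then have "X \<notin> E"
        using E_norm \<open>X \<in> \<Omega>\<close> t(1) unfolding normalized_in_def \<Omega>_def by blast
      then show False using XE by blast
    qed
  qed
  then show "\<exists>\<delta>>0. E \<inter> (ball 0 \<delta> \<times> UNIV) \<subseteq> {X. snd X \<le> \<epsilon>}"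
    using \<delta> \<rho>1 by (intro exI[of _ "min \<delta> \<rho>1"]) simp
qed

end
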